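(* Let $n\ge 3$. The group $\Gamma_n^*$ of polynomial automorphisms of $\mathbb{C}^n$ preserving the Markoff-Hurwitz polynomial $$H(x_1,\dots,x_n)=x_1^2+x_2^2+\cdots+x_n^2-x_1x_2\cdots x_n$$ is given by $\Gamma_n^*=\Gamma_n\rtimes\Lambda$ (with $\Gamma_n$ normal), where: (1) $\Lambda$ is the group of linear automorphisms of $\mathbb{C}^n$ preserving $H$, and $\Lambda=\Upsilon_n\rtimes S_n$ (with $\Upsilon_n$ normal), where $\Upsilon_n$ is the group of even sign change automorphisms and $S_n$ is the symmetric group acting by permutations of the coordinates; (2) $\Gamma_n$ is the group generated by the maps $b_1,\dots,b_n:\mathbb{C}^n\to\mathbb{C}^n$, $$b_i(x_1,\dots,x_i,\dots,x_n)=\Big(x_1,\dots,x_{i-1},\ \prod_{j\ne i}x_j-x_i,\ x_{i+1},\dots,x_n\Big),$$ and it has the presentation $\Gamma_n=\langle b_1,\dots,b_n\mid b_i^2=\mathrm{Id},\ i=1,\dots,n\rangle$. In particular, $\Gamma_n$ is a normal subgroup of finite index in $\Gamma_n^*$.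
   Context: A polynomial automorphism of $\mathbb{C}^n$ is a bijection $\mathbb{C}^n\to\mathbb{C}^n$ that is polynomial with polynomial inverse; it preserves $H$ if $H\circ\Theta=H$. An even sign change automorphism is a map $(x_1,\dots,x_n)\mapsto(\epsilon_1x_1,\dots,\epsilon_nx_n)$ with $\epsilon_i\in\{1,-1\}$ and an even number of the $\epsilon_i$ equal to $-1$. *)

theory Defs
  imports "HOL-Analysis.Analysis" "HOL-Algebra.Coset" "HOL-Algebra.Bij"
    "HOL-Algebra.Generated_Groups"
begin

section \<open>Internal semidirect products\<close>

definition semidirect_product :: "('a, 'b) monoid_scheme \<Rightarrow> 'a set \<Rightarrow> 'a set \<Rightarrow> bool" where
  "semidirect_product G N K \<longleftrightarrow>
     N \<lhd> G \<and> subgroup K G \<and> N \<inter> K = {\<one>\<^bsub>G\<^esub>} \<and> N <#>\<^bsub>G\<^esub> K = carrier G"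


section \<open>Free groups and presentations\<close>

text \<open>The letter \<open>(i, True)\<close> stands for the generator indexed by \<open>i\<close>, and \<open>(i, False)\<close> for its
  formal inverse. The free group on the type \<open>'i\<close> consists of the words in these letters
  modulo insertion and deletion of adjacent mutually inverse letters.\<close>

type_synonym 'i word = "('i \<times> bool) list"

inductive cancels :: "'i word \<Rightarrow> 'i word \<Rightarrow> bool" where
  "cancels (u @ [(i, s), (i, \<not> s)] @ v) (u @ v)"

definition word_rel :: "('i word \<times> 'i word) set" where
  "word_rel = {(u, v). equivclp cancels u v}"

definition free_group :: "'i word set monoid" where
  "free_group =
     \<lparr>carrier = UNIV // word_rel,
      mult = \<lambda>A B. \<Union>u\<in>A. \<Union>v\<in>B. word_rel `` {u @ v},
      one = word_rel `` {[]}\<rparr>"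

definition free_gen :: "'i \<Rightarrow> 'i word set" where
  "free_gen i = word_rel `` {[(i, True)]}"

definition normal_closure :: "('a, 'b) monoid_scheme \<Rightarrow> 'a set \<Rightarrow> 'a set" where
  "normal_closure G R = \<Inter> {N. N \<lhd> G \<and> R \<subseteq> N}"

text \<open>The group \<open>G\<close> has the presentation with generators \<open>b i\<close> and relators \<open>R\<close> (elements of the
  free group): the homomorphism from the free group determined by \<open>b\<close> is onto \<open>G\<close>, and its
  kernel is the normal closure of \<open>R\<close>.\<close>

definition has_presentation ::
    "('a, 'b) monoid_scheme \<Rightarrow> ('i \<Rightarrow> 'a) \<Rightarrow> 'i word set set \<Rightarrow> bool" where
  "has_presentation G b R \<longleftrightarrow>
     group G \<and>
     (\<exists>\<phi> \<in> hom free_group G. (\<forall>i. \<phi> (free_gen i) = b i) \<and>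
        \<phi> ` carrier free_group = carrier G \<and>
        kernel free_group G \<phi> = normal_closure free_group R)"

lemma equiv_word_rel: "equiv UNIV word_rel"
proof (rule equivI)
  show "refl word_rel" by (simp add: refl_on_def word_rel_def)
  show "sym word_rel" by (auto simp: sym_def word_rel_def intro: equivclp_sym)
  show "trans word_rel" by (auto simp: trans_def word_rel_def intro: equivclp_trans)
qed simp

lemma cancels_append_left: "cancels u v \<Longrightarrow> cancels (w @ u) (w @ v)"
proof (induction rule: cancels.induct)
  case (1 u i s v)
  show ?case using cancels.intros[of "w @ u" i s v] by simp
qed

lemma cancels_append_right: "cancels u v \<Longrightarrow> cancels (u @ w) (v @ w)"
proof (induction rule: cancels.induct)
  case (1 u i s v)
  show ?case using cancels.intros[of u i s "v @ w"] by simp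
qed

lemma word_rel_mono:
  assumes "\<And>u v. cancels u v \<Longrightarrow> cancels (f u) (f v)" and "(u, v) \<in> word_rel"
  shows "(f u, f v) \<in> word_rel"
proof -
  have "equivclp cancels u v" using assms(2) by (simp add: word_rel_def)
  then have "equivclp cancels (f u) (f v)"
  proof (induction rule: equivclp_induct)
    case base
    then show ?case by simp
  next
    case (step y z)
    then have "equivclp cancels (f y) (f z)"
      using assms(1) by (auto intro: r_into_equivclp converse_r_into_equivclp)
    with step show ?case by (blast intro: equivclp_trans)
  qed
  then show ?thesis by (simp add: word_rel_def)
qed

lemma word_rel_append:
  assumes "(u, u') \<in> word_rel" "(v, v') \<in> word_rel"
  shows "(u @ v, u' @ v') \<in> word_rel"
proof -
  have "(u @ v, u' @ v) \<in> word_rel"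
    by (rule word_rel_mono[where f = "\<lambda>x. x @ v", OF cancels_append_right assms(1)])
  moreover have "(u' @ v, u' @ v') \<in> word_rel"
    by (rule word_rel_mono[where f = "\<lambda>x. u' @ x", OF cancels_append_left assms(2)])
  ultimately show ?thesis
    using equiv_word_rel by (meson equivE transE)
qed

lemma free_group_mult:
  "word_rel `` {u} \<otimes>\<^bsub>free_group\<^esub> word_rel `` {v} = word_rel `` {u @ v}"
proof -
  have eq: "word_rel `` {u' @ v'} = word_rel `` {u @ v}"
    if "(u, u') \<in> word_rel" "(v, v') \<in> word_rel" for u' v'
    using equiv_class_eq[OF equiv_word_rel word_rel_append[OF that]] by simp
  have "word_rel `` {u} \<otimes>\<^bsub>free_group\<^esub> word_rel `` {v} =
      (\<Union>u' \<in> word_rel `` {u}. \<Union>v' \<in> word_rel `` {v}. word_rel `` {u' @ v'})"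
    by (simp add: free_group_def)
  also have "\<dots> = (\<Union>u' \<in> word_rel `` {u}. \<Union>v' \<in> word_rel `` {v}. word_rel `` {u @ v})"
    by (intro SUP_cong refl eq) simp_all
  also have "\<dots> = word_rel `` {u @ v}"
  proof -
    have "u \<in> word_rel `` {u}" "v \<in> word_rel `` {v}"
      by (simp_all add: word_rel_def)
    then show ?thesis by blast
  qed
  finally show ?thesis .
qed

lemma word_rel_inverse:
  "(map (\<lambda>(i, s). (i, \<not> s)) (rev w) @ w, []) \<in> word_rel"
proof (induction w)
  case Nil
  then show ?case by (simp add: word_rel_def)
next
  case (Cons a w)
  obtain i s where a: "a = (i, s)" by (cases a)
  let ?r = "map (\<lambda>(i, s). (i, \<not> s)) (rev w)"
  have "cancels (?r @ [(i, \<not> s), (i, \<not> \<not> s)] @ w) (?r @ w)" by (rule cancels.intros)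
  then have "(map (\<lambda>(i, s). (i, \<not> s)) (rev (a # w)) @ a # w, ?r @ w) \<in> word_rel"
    by (auto simp: word_rel_def a)
  with Cons show ?case using equiv_word_rel by (meson equivE transE)
qed

lemma group_free_group: "group free_group"
proof (rule groupI)
  have carrier_eq: "carrier free_group = range (\<lambda>u. word_rel `` {u})"
    by (auto simp: free_group_def quotient_def)
  have one_eq: "\<one>\<^bsub>free_group\<^esub> = word_rel `` {[]}"
    by (simp add: free_group_def)
  show "\<one>\<^bsub>free_group\<^esub> \<in> carrier free_group"
    by (auto simp: carrier_eq one_eq)
  fix x :: "'a word set" assume "x \<in> carrier free_group"
  then obtain u where u: "x = word_rel `` {u}" by (auto simp: carrier_eq)
  show "\<one>\<^bsub>free_group\<^esub> \<otimes>\<^bsub>free_group\<^esub> x = x"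
    by (simp add: u one_eq free_group_mult)
  show "\<exists>y\<in>carrier free_group. y \<otimes>\<^bsub>free_group\<^esub> x = \<one>\<^bsub>free_group\<^esub>"
    by (rule bexI[where x = "word_rel `` {map (\<lambda>(i, s). (i, \<not> s)) (rev u)}"])
      (simp_all add: u one_eq carrier_eq free_group_mult
        equiv_class_eq[OF equiv_word_rel word_rel_inverse])
  fix y :: "'a word set" assume "y \<in> carrier free_group"
  then obtain v where v: "y = word_rel `` {v}" by (auto simp: carrier_eq)
  show "x \<otimes>\<^bsub>free_group\<^esub> y \<in> carrier free_group"
    by (simp add: u v carrier_eq free_group_mult)
  fix z :: "'a word set" assume "z \<in> carrier free_group"
  then obtain w where w: "z = word_rel `` {w}" by (auto simp: carrier_eq)
  show "x \<otimes>\<^bsub>free_group\<^esub> y \<otimes>\<^bsub>free_group\<^esub> z = x \<otimes>\<^bsub>free_group\<^esub> (y \<otimes>\<^bsub>free_group\<^esub> z)"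
    by (simp add: u v w free_group_mult)
qed


section \<open>Polynomial automorphisms and the Markoff-Hurwitz polynomial\<close>

text \<open>A polynomial function is a finite sum of monomials; the set \<open>M\<close> is its set of exponent
  vectors and \<open>c\<close> its coefficients.\<close>

definition polynomial_function_complex :: "(complex ^ 'n \<Rightarrow> complex) \<Rightarrow> bool" where
  "polynomial_function_complex f \<longleftrightarrow>
     (\<exists>(M :: ('n \<Rightarrow> nat) set) c. finite M \<and>
        (\<forall>x. f x = (\<Sum>m\<in>M. c m * (\<Prod>i\<in>UNIV. (x $ i) ^ m i))))"

definition polynomial_map :: "(complex ^ 'n \<Rightarrow> complex ^ 'n) \<Rightarrow> bool" where
  "polynomial_map F \<longleftrightarrow> (\<forall>i. polynomial_function_complex (\<lambda>x. F x $ i))"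

definition polynomial_automorphism :: "(complex ^ 'n \<Rightarrow> complex ^ 'n) \<Rightarrow> bool" where
  "polynomial_automorphism \<Theta> \<longleftrightarrow>
     bij \<Theta> \<and> polynomial_map \<Theta> \<and> polynomial_map (inv_into UNIV \<Theta>)"

text \<open>Note that the constant \<open>linear\<close> of the analysis library is linearity over the reals;
  here it is linearity over the complex numbers that is needed.\<close>

definition linear_automorphism :: "(complex ^ 'n \<Rightarrow> complex ^ 'n) \<Rightarrow> bool" where
  "linear_automorphism \<Theta> \<longleftrightarrow> bij \<Theta> \<and> Vector_Spaces.linear (*s) (*s) \<Theta>"

definition markoff_hurwitz :: "complex ^ 'n \<Rightarrow> complex" where
  "markoff_hurwitz x = (\<Sum>i\<in>UNIV. (x $ i)\<^sup>2) - (\<Prod>i\<in>UNIV. x $ i)"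

definition preserves :: "('a \<Rightarrow> 'a) \<Rightarrow> ('a \<Rightarrow> 'b) \<Rightarrow> bool" where
  "preserves \<Theta> H \<longleftrightarrow> H \<circ> \<Theta> = H"

definition Gamma_star :: "(complex ^ 'n \<Rightarrow> complex ^ 'n) set" where
  "Gamma_star = {\<Theta>. polynomial_automorphism \<Theta> \<and> preserves \<Theta> markoff_hurwitz}"

definition Lambda :: "(complex ^ 'n \<Rightarrow> complex ^ 'n) set" where
  "Lambda = {\<Theta>. linear_automorphism \<Theta> \<and> preserves \<Theta> markoff_hurwitz}"

definition sign_change :: "('n \<Rightarrow> complex) \<Rightarrow> complex ^ 'n \<Rightarrow> complex ^ 'n" where
  "sign_change \<epsilon> x = (\<chi> i. \<epsilon> i * x $ i)"

definition Upsilon :: "(complex ^ 'n \<Rightarrow> complex ^ 'n) set" where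
  "Upsilon = {sign_change \<epsilon> | \<epsilon>. (\<forall>i. \<epsilon> i \<in> {1, -1}) \<and> even (card {i. \<epsilon> i = -1})}"

text \<open>The inverse makes this a left action: \<open>\<sigma>\<close> moves the entry in position \<open>i\<close> to
  position \<open>\<sigma> i\<close>.\<close>

definition permute_coords :: "('n \<Rightarrow> 'n) \<Rightarrow> complex ^ 'n \<Rightarrow> complex ^ 'n" where
  "permute_coords \<sigma> x = (\<chi> i. x $ inv_into UNIV \<sigma> i)"

definition Perms :: "(complex ^ 'n \<Rightarrow> complex ^ 'n) set" where
  "Perms = permute_coords ` {\<sigma>. bij \<sigma>}"

definition b_map :: "'n \<Rightarrow> complex ^ 'n \<Rightarrow> complex ^ 'n" where
  "b_map i x = (\<chi> k. if k = i then (\<Prod>j\<in>UNIV - {i}. x $ j) - x $ i else x $ k)"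

definition Gamma_group :: "(complex ^ 'n \<Rightarrow> complex ^ 'n) set" where
  "Gamma_group = generate (BijGroup UNIV) (range b_map)"

text \<open>A set of bijections regarded as a group under composition.\<close>

abbreviation transformation_group :: "('a \<Rightarrow> 'a) set \<Rightarrow> ('a \<Rightarrow> 'a) monoid" where
  "transformation_group A \<equiv> (BijGroup UNIV)\<lparr>carrier := A\<rparr>"

end

(* Let Theta be a polynomial automorphism preserving H, with components of degrees d_1, ..., d_n.
   If the sum of the d_i exceeds n, the identity H o Theta = H forces the terms of top degree in
   the product and in the squares to cancel, so that some d_k is the sum of the other degrees and
   composing with b_k lowers d_k. Descent leaves an affine map preserving H, and comparing terms of
   degree n shows that it permutes the coordinates up to an even number of signs. Degrees are
   measured by restricting to lines through the origin in generic position, which reduces every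
   argument on degrees to polynomials in one variable.

   The presentation and the trivial intersection of the two factors follow from ping-pong: starting
   at (3, ..., 3), after a reduced word ending with b_j the j-th coordinate is the unique largest
   one, and it exceeds 3. *)

theory Submission
  imports Defs "HOL-Computational_Algebra.Polynomial"
begin

section \<open>Polynomial functions\<close>

text \<open>One direction \<open>v\<close> has to exhibit the degrees of all \<open>2n\<close>
  functions involved, the coordinates of \<open>\<Theta>\<close> and their reflections. This works
  because the coefficient of \<open>t ^ d\<close> on the line through \<open>v\<close> is itself a
  polynomial function of \<open>v\<close>, and finitely many nonzero polynomial functions have a
  common point of nonvanishing. Nonconstancy, which makes the degrees positive, comes from
  surjectivity. For an affine map the terms of degree \<open>n\<close> say only that the linear
  parts multiply to the product of the coordinates, so they are multiples \<open>a i\<close> of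
  permuted coordinates with product 1. That the translation vanishes and that each
  \<open>a i\<close> is a sign is read off from values of \<open>H\<close> at special points. The
  condition \<open>n \<ge> 3\<close> recurs: the squares have degree below \<open>n\<close>, the
  maximal degree in the descent is strictly maximal, and the product in a reflection has a third
  factor. At the point (3, ..., 3) this factor is at least 3, which beats the subtracted coordinate.
  Signed permutations only produce entries 3 and -3 there, so the same point serves both the
  presentation and the trivial intersection.\<close>

definition monom_fun :: "('n::finite \<Rightarrow> nat) \<Rightarrow> complex ^ 'n \<Rightarrow> complex" where
  "monom_fun m x = (\<Prod>i\<in>UNIV. (x $ i) ^ m i)"

text \<open>The definition sums over a set of exponent vectors, whereas sums and products produce
  the same exponent repeatedly. An arbitrary index set is allowed here, and equal exponents are
  collected.\<close>

lemma polynomial_function_complexI: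
  fixes f :: "complex ^ 'n::finite \<Rightarrow> complex"
  assumes "finite I" and "\<And>x. f x = (\<Sum>k\<in>I. c k * monom_fun (e k) x)"
  shows "polynomial_function_complex f"
  unfolding polynomial_function_complex_def
proof (intro exI conjI allI)
  show "finite (e ` I)" using assms(1) by simp
  fix x
  have "f x = (\<Sum>m\<in>e ` I. \<Sum>k | k \<in> I \<and> e k = m. c k * monom_fun (e k) x)"
    unfolding assms(2) by (rule sum.image_gen[OF assms(1)])
  also have "\<dots> = (\<Sum>m\<in>e ` I. (\<Sum>k | k \<in> I \<and> e k = m. c k) * monom_fun m x)"
    by (intro sum.cong refl) (simp add: sum_distrib_right)
  finally show "f x = (\<Sum>m\<in>e ` I. (\<Sum>k | k \<in> I \<and> e k = m. c k) * (\<Prod>i\<in>UNIV. (x $ i) ^ m i))"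
    by (simp add: monom_fun_def)
qed

lemma polynomial_function_complexE:
  fixes f :: "complex ^ 'n::finite \<Rightarrow> complex"
  assumes "polynomial_function_complex f"
  obtains M c where "finite M" and "\<And>x. f x = (\<Sum>m\<in>M. c m * monom_fun m x)"
  using assms unfolding polynomial_function_complex_def monom_fun_def by blast

lemma monom_fun_add: "monom_fun (\<lambda>i. m i + m' i) x = monom_fun m x * monom_fun m' x"
  by (simp add: monom_fun_def power_add prod.distrib)

lemma polynomial_function_complex_const:
  "polynomial_function_complex (\<lambda>x :: complex ^ 'n::finite. a)"
  by (rule polynomial_function_complexI[where I = "{()}" and c = "\<lambda>_. a" and e = "\<lambda>_ _. 0"])
    (simp_all add: monom_fun_def)

lemma polynomial_function_complex_coord:
  "polynomial_function_complex (\<lambda>x :: complex ^ 'n::finite. x $ i)"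
  by (rule polynomial_function_complexI[where I = "{()}" and c = "\<lambda>_. 1"
        and e = "\<lambda>_ j. if j = i then 1 else 0"])
    (simp_all add: monom_fun_def if_distrib cong: if_cong)

lemma polynomial_function_complex_add:
  fixes f :: "complex ^ 'n::finite \<Rightarrow> complex"
  assumes "polynomial_function_complex f" "polynomial_function_complex g"
  shows "polynomial_function_complex (\<lambda>x. f x + g x)"
proof -
  obtain M c where M: "finite M" "\<And>x. f x = (\<Sum>m\<in>M. c m * monom_fun m x)"
    using assms(1) by (rule polynomial_function_complexE) (rule that)
  obtain M' c' where M': "finite M'" "\<And>x. g x = (\<Sum>m\<in>M'. c' m * monom_fun m x)"
    using assms(2) by (rule polynomial_function_complexE) (rule that)
  show ?thesis
    by (rule polynomial_function_complexI[where I = "M <+> M'" and c = "case_sum c c'"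
          and e = "case_sum id id"]) (simp_all add: M M' sum.Plus)
qed

lemma polynomial_function_complex_mult:
  fixes f :: "complex ^ 'n::finite \<Rightarrow> complex"
  assumes "polynomial_function_complex f" "polynomial_function_complex g"
  shows "polynomial_function_complex (\<lambda>x. f x * g x)"
proof -
  obtain M c where M: "finite M" "\<And>x. f x = (\<Sum>m\<in>M. c m * monom_fun m x)"
    using assms(1) by (rule polynomial_function_complexE) (rule that)
  obtain M' c' where M': "finite M'" "\<And>x. g x = (\<Sum>m\<in>M'. c' m * monom_fun m x)"
    using assms(2) by (rule polynomial_function_complexE) (rule that)
  show ?thesis
  proof (rule polynomial_function_complexI[where I = "M \<times> M'"
        and c = "\<lambda>k. c (fst k) * c' (snd k)" and e = "\<lambda>k i. fst k i + snd k i"])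
    show "f x * g x =
        (\<Sum>k\<in>M \<times> M'. c (fst k) * c' (snd k) * monom_fun (\<lambda>i. fst k i + snd k i) x)" for x
      unfolding M(2) M'(2) sum_product sum.cartesian_product monom_fun_add
      by (rule sum.cong) (simp_all add: case_prod_beta)
  qed (simp add: M M')
qed

lemma polynomial_function_complex_diff:
  fixes f :: "complex ^ 'n::finite \<Rightarrow> complex"
  assumes "polynomial_function_complex f" "polynomial_function_complex g"
  shows "polynomial_function_complex (\<lambda>x. f x - g x)"
  using polynomial_function_complex_add[OF assms(1)
      polynomial_function_complex_mult[OF polynomial_function_complex_const[of "-1"] assms(2)]]
  by simp

lemma polynomial_function_complex_power:
  fixes f :: "complex ^ 'n::finite \<Rightarrow> complex"
  assumes "polynomial_function_complex f"
  shows "polynomial_function_complex (\<lambda>x. f x ^ k)"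
  by (induction k)
    (simp_all add: assms polynomial_function_complex_const polynomial_function_complex_mult)

lemma polynomial_function_complex_sum:
  fixes f :: "'i \<Rightarrow> complex ^ 'n::finite \<Rightarrow> complex"
  assumes "\<And>i. i \<in> I \<Longrightarrow> polynomial_function_complex (f i)"
  shows "polynomial_function_complex (\<lambda>x. \<Sum>i\<in>I. f i x)"
  using assms
  by (induction I rule: infinite_finite_induct)
    (simp_all add: polynomial_function_complex_const polynomial_function_complex_add)

lemma polynomial_function_complex_prod:
  fixes f :: "'i \<Rightarrow> complex ^ 'n::finite \<Rightarrow> complex"
  assumes "\<And>i. i \<in> I \<Longrightarrow> polynomial_function_complex (f i)"
  shows "polynomial_function_complex (\<lambda>x. \<Prod>i\<in>I. f i x)"
  using assms
  by (induction I rule: infinite_finite_induct)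
    (simp_all add: polynomial_function_complex_const polynomial_function_complex_mult)

lemmas polynomial_function_complex_intros =
  polynomial_function_complex_const polynomial_function_complex_coord
  polynomial_function_complex_add polynomial_function_complex_mult
  polynomial_function_complex_diff polynomial_function_complex_power
  polynomial_function_complex_sum polynomial_function_complex_prod

lemma polynomial_function_complex_compose:
  fixes f :: "complex ^ 'n::finite \<Rightarrow> complex" and F :: "complex ^ 'n \<Rightarrow> complex ^ 'n"
  assumes "polynomial_function_complex f" "polynomial_map F"
  shows "polynomial_function_complex (\<lambda>x. f (F x))"
proof -
  obtain M c where M: "finite M" "\<And>x. f x = (\<Sum>m\<in>M. c m * monom_fun m x)"
    using assms(1) by (rule polynomial_function_complexE) (rule that)
  have "polynomial_function_complex (\<lambda>x. F x $ i)" for i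
    using assms(2) by (auto simp: polynomial_map_def o_def)
  then show ?thesis
    unfolding M(2) monom_fun_def by (intro polynomial_function_complex_intros)
qed

lemma polynomial_map_compose:
  assumes "polynomial_map F" "polynomial_map G"
  shows "polynomial_map (F \<circ> G)"
  using assms polynomial_function_complex_compose[OF _ assms(2)]
  by (auto simp: polynomial_map_def o_def)

text \<open>The degree arguments use base point 0; a general base point is needed to join two given
  points by a line.\<close>

lemma polynomial_function_complex_line:
  fixes f :: "complex ^ 'n::finite \<Rightarrow> complex"
  assumes "polynomial_function_complex f"
  shows "\<exists>p. \<forall>t. poly p t = f (a + t *s b)"
proof -
  obtain M c where M: "finite M" "\<And>x. f x = (\<Sum>m\<in>M. c m * monom_fun m x)"
    using assms by (rule polynomial_function_complexE) (rule that)
  show ?thesis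
    by (rule exI[where x = "\<Sum>m\<in>M. [:c m:] * (\<Prod>i\<in>UNIV. [:a $ i, b $ i:] ^ m i)"])
      (simp add: M(2) poly_sum poly_prod monom_fun_def)
qed

text \<open>Induction: join a point that is good for \<open>I\<close> to one that is good for
  \<open>k\<close>. On this line every function restricts to a nonzero polynomial in one variable,
  and the product of these has a non-root.\<close>

lemma polynomial_functions_common_nonzero:
  fixes f :: "'i \<Rightarrow> complex ^ 'n::finite \<Rightarrow> complex"
  assumes "finite I" and "\<And>i. i \<in> I \<Longrightarrow> polynomial_function_complex (f i)"
    and "\<And>i. i \<in> I \<Longrightarrow> \<exists>v. f i v \<noteq> 0"
  shows "\<exists>v. \<forall>i\<in>I. f i v \<noteq> 0"
  using assms
proof (induction I rule: finite_induct)
  case empty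
  then show ?case by simp
next
  case (insert k I)
  have "\<exists>v. \<forall>i\<in>I. f i v \<noteq> 0"
    by (rule insert.IH) (use insert.prems in simp_all)
  then obtain a where a: "\<forall>i\<in>I. f i a \<noteq> 0" ..
  obtain b where b: "f k b \<noteq> 0" using insert.prems(2)[of k] by auto
  have "\<forall>i\<in>insert k I. \<exists>p. \<forall>t. poly p t = f i (a + t *s (b - a))"
    by (intro ballI polynomial_function_complex_line insert.prems(1))
  then have "\<exists>p. \<forall>i\<in>insert k I. \<forall>t. poly (p i) t = f i (a + t *s (b - a))"
    by (rule bchoice)
  then obtain p where p: "\<And>i t. i \<in> insert k I \<Longrightarrow> poly (p i) t = f i (a + t *s (b - a))"
    by blast
  have "p i \<noteq> 0" if "i \<in> I" for i
    using p[of i 0] a that by auto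
  moreover have "p k \<noteq> 0"
    using p[of k 1] b by auto
  ultimately have "(\<Prod>i\<in>insert k I. p i) \<noteq> 0"
    using insert.hyps(1) by auto
  then obtain t where "poly (\<Prod>i\<in>insert k I. p i) t \<noteq> 0"
    using poly_all_0_iff_0 by blast
  then have "\<forall>i\<in>insert k I. poly (p i) t \<noteq> 0"
    using insert.hyps(1) by (auto simp: poly_prod)
  then show ?case using p by auto
qed


section \<open>Degrees along lines through the origin\<close>

text \<open>A complex polynomial is determined by its values, so the description is unique as soon
  as \<open>f\<close> is polynomial.\<close>

definition line_poly :: "(complex ^ 'n::finite \<Rightarrow> complex) \<Rightarrow> complex ^ 'n \<Rightarrow> complex poly" where
  "line_poly f v = (THE p. \<forall>t. poly p t = f (t *s v))"

lemma line_poly_eqI: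
  assumes "\<And>t. poly p t = f (t *s v)"
  shows "line_poly f v = p"
  unfolding line_poly_def
  by (rule the_equality) (use assms in \<open>auto simp: poly_eq_poly_eq_iff[symmetric] fun_eq_iff\<close>)

lemma monom_fun_scale: "monom_fun m (t *s v) = t ^ (\<Sum>i\<in>UNIV. m i) * monom_fun m v"
  by (simp add: monom_fun_def power_mult_distrib prod.distrib power_sum)

lemma line_poly_expansion:
  assumes "finite M" "\<And>x. f x = (\<Sum>m\<in>M. c m * monom_fun m x)"
  shows "line_poly f v = (\<Sum>m\<in>M. monom (c m * monom_fun m v) (\<Sum>i\<in>UNIV. m i))"
  by (rule line_poly_eqI) (simp add: assms(2) poly_sum poly_monom monom_fun_scale ac_simps)

lemma poly_line_poly:
  assumes "polynomial_function_complex f"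
  shows "poly (line_poly f v) t = f (t *s v)"
proof -
  obtain p where "\<forall>t. poly p t = f (0 + t *s v)"
    using polynomial_function_complex_line[OF assms] by blast
  then show ?thesis using line_poly_eqI[of p f v] by simp
qed

text \<open>The coefficient of degree \<open>d\<close> is the homogeneous part of \<open>f\<close>
  of degree \<open>d\<close>, evaluated at \<open>v\<close>. This makes nonvanishing of a top
  coefficient a generic condition on \<open>v\<close>.\<close>

lemma coeff_line_poly_expansion:
  assumes "finite M" "\<And>x. f x = (\<Sum>m\<in>M. c m * monom_fun m x)"
  shows "coeff (line_poly f v) d = (\<Sum>m | m \<in> M \<and> (\<Sum>i\<in>UNIV. m i) = d. c m * monom_fun m v)"
  by (simp add: line_poly_expansion[OF assms] coeff_sum if_distrib sum.If_cases[OF assms(1)]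
      sum.inter_filter[OF assms(1)])

lemma polynomial_function_complex_coeff_line_poly:
  fixes f :: "complex ^ 'n::finite \<Rightarrow> complex"
  assumes "polynomial_function_complex f"
  shows "polynomial_function_complex (\<lambda>v. coeff (line_poly f v) d)"
proof -
  obtain M c where M: "finite M" "\<And>x. f x = (\<Sum>m\<in>M. c m * monom_fun m x)"
    using assms by (rule polynomial_function_complexE) (rule that)
  show ?thesis
    by (rule polynomial_function_complexI[where I = "{m \<in> M. (\<Sum>i\<in>UNIV. m i) = d}" and c = c
          and e = "\<lambda>m. m"]) (simp_all add: M(1) coeff_line_poly_expansion[OF M])
qed

text \<open>The total degree of \<open>f\<close>, defined from the function alone and not from a
  chosen expansion; constants, including 0, get degree 0.\<close>

definition line_degree :: "(complex ^ 'n::finite \<Rightarrow> complex) \<Rightarrow> nat" where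
  "line_degree f = Max (range (\<lambda>v. degree (line_poly f v)))"

lemma finite_line_degrees:
  fixes f :: "complex ^ 'n::finite \<Rightarrow> complex"
  assumes "polynomial_function_complex f"
  shows "finite (range (\<lambda>v. degree (line_poly f v)))"
proof -
  obtain M c where M: "finite M" "\<And>x. f x = (\<Sum>m\<in>M. c m * monom_fun m x)"
    using assms by (rule polynomial_function_complexE) (rule that)
  have "degree (line_poly f v) \<le> (\<Sum>m\<in>M. \<Sum>i\<in>UNIV. m i)" for v
    unfolding line_poly_expansion[OF M]
    by (intro degree_sum_le[OF M(1)] order.trans[OF degree_monom_le] member_le_sum) (simp_all add: M)
  then show ?thesis
    by (auto simp: finite_nat_set_iff_bounded_le)
qed

lemma degree_line_poly_le:
  assumes "polynomial_function_complex f"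
  shows "degree (line_poly f v) \<le> line_degree f"
  unfolding line_degree_def by (rule Max_ge[OF finite_line_degrees[OF assms]]) simp

lemma line_degree_attained:
  assumes "polynomial_function_complex f"
  shows "\<exists>v. degree (line_poly f v) = line_degree f"
  using Max_in[OF finite_line_degrees[OF assms]] unfolding line_degree_def by auto

text \<open>In degree 0 the function is constant on every line through the origin, hence equal to
  \<open>f 0\<close> everywhere.\<close>

lemma line_degree_pos:
  assumes "polynomial_function_complex f" "f x \<noteq> f y"
  shows "line_degree f \<ge> 1"
proof (rule ccontr)
  assume "\<not> ?thesis"
  then have "degree (line_poly f v) = 0" for v
    using degree_line_poly_le[OF assms(1), of v] by simp
  then have "poly (line_poly f v) 1 = poly (line_poly f v) 0" for v
    by (metis degree_eq_zeroE mult_zero_right poly_0 poly_pCons)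
  then have "f v = f 0" for v
    by (simp add: poly_line_poly[OF assms(1)])
  then show False using assms(2) by metis
qed

lemma line_degrees_attained_simultaneously:
  fixes f :: "'i \<Rightarrow> complex ^ 'n::finite \<Rightarrow> complex"
  assumes "finite I" and "\<And>i. i \<in> I \<Longrightarrow> polynomial_function_complex (f i)"
    and "\<And>i. i \<in> I \<Longrightarrow> line_degree (f i) \<ge> 1"
  shows "\<exists>v. \<forall>i\<in>I. degree (line_poly (f i) v) = line_degree (f i)"
proof -
  have "\<exists>v. \<forall>i\<in>I. coeff (line_poly (f i) v) (line_degree (f i)) \<noteq> 0"
  proof (rule polynomial_functions_common_nonzero[OF assms(1)])
    fix i assume i: "i \<in> I"
    show "polynomial_function_complex (\<lambda>v. coeff (line_poly (f i) v) (line_degree (f i)))"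
      by (rule polynomial_function_complex_coeff_line_poly[OF assms(2)[OF i]])
    obtain v where "degree (line_poly (f i) v) = line_degree (f i)"
      using line_degree_attained[OF assms(2)[OF i]] by blast
    \<comment> \<open>A positive degree excludes the zero polynomial, whose leading coefficient
      would vanish.\<close>
    then show "\<exists>v. coeff (line_poly (f i) v) (line_degree (f i)) \<noteq> 0"
      using assms(3)[OF i] by (metis degree_0 leading_coeff_0_iff not_one_le_zero)
  qed
  then show ?thesis
    using assms(2) degree_line_poly_le le_degree by (metis order.antisym)
qed

text \<open>Evaluating the line polynomial at \<open>t = 1\<close> gives \<open>f x\<close> as
  \<open>f 0\<close> plus the coefficient of degree 1. Only exponent vectors of total degree 1
  contribute to it, and these are unit vectors; terms of higher degree in the expansion never have
  to be examined.\<close>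

lemma line_degree_le_1_affine:
  fixes f :: "complex ^ 'n::finite \<Rightarrow> complex"
  assumes "polynomial_function_complex f" "line_degree f \<le> 1"
  shows "\<exists>a. \<forall>x. f x = f 0 + (\<Sum>j\<in>UNIV. a j * x $ j)"
proof -
  obtain M c where M: "finite M" "\<And>x. f x = (\<Sum>m\<in>M. c m * monom_fun m x)"
    using assms(1) by (rule polynomial_function_complexE) (rule that)
  let ?M1 = "{m \<in> M. (\<Sum>i\<in>UNIV. m i) = 1}"
  have "\<exists>j. m = (\<lambda>i. if i = j then 1 else 0)" if "m \<in> ?M1" for m
  proof -
    from that have s: "(\<Sum>i\<in>UNIV. m i) = 1" by simp
    then obtain j where j: "m j = 1" "\<And>i. i \<noteq> j \<Longrightarrow> m i = 0"
      using sum_eq_1_iff[of UNIV m] by (metis UNIV_I finite)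
    then have "m = (\<lambda>i. if i = j then 1 else 0)" by (auto simp: fun_eq_iff)
    then show ?thesis ..
  qed
  then have "\<exists>J. \<forall>m\<in>?M1. m = (\<lambda>i. if i = J m then 1 else 0)"
    by (intro bchoice ballI)
  then obtain J where J: "\<And>m. m \<in> ?M1 \<Longrightarrow> m = (\<lambda>i. if i = J m then 1 else 0)"
    by (elim exE) blast
  have J': "monom_fun m x = x $ J m" if "m \<in> ?M1" for m x
    by (subst J[OF that]) (simp add: monom_fun_def if_distrib cong: if_cong)
  have expand: "f x = f 0 + (\<Sum>j\<in>UNIV. (\<Sum>m | m \<in> ?M1 \<and> J m = j. c m) * x $ j)" for x
  proof -
    have "degree (line_poly f x) \<le> 1"
      using degree_line_poly_le[OF assms(1), of x] assms(2) by simp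
    then have "line_poly f x = [:coeff (line_poly f x) 0, coeff (line_poly f x) 1:]"
      by (intro poly_eqI) (auto simp: coeff_pCons coeff_eq_0 split: nat.split)
    then have "poly (line_poly f x) 1 = poly (line_poly f x) 0 + coeff (line_poly f x) 1"
      by (metis add_0 add.right_neutral mult_1 mult_zero_left poly_0 poly_pCons)
    then have "f x = f 0 + coeff (line_poly f x) 1"
      by (simp add: poly_line_poly[OF assms(1)])
    also have "coeff (line_poly f x) 1 = (\<Sum>m\<in>?M1. c m * x $ J m)"
      unfolding coeff_line_poly_expansion[OF M] by (rule sum.cong) (simp_all add: J')
    also have "\<dots> = (\<Sum>j\<in>UNIV. \<Sum>m | m \<in> ?M1 \<and> J m = j. c m * x $ J m)"
      by (rule sum.group[symmetric]) (simp_all add: M)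
    also have "\<dots> = (\<Sum>j\<in>UNIV. (\<Sum>m | m \<in> ?M1 \<and> J m = j. c m) * x $ j)"
      by (intro sum.cong refl) (simp add: sum_distrib_right)
    finally show ?thesis .
  qed
  show ?thesis by (intro exI allI) (rule expand)
qed


section \<open>Descent of degrees\<close>

lemma exists_index_maximum:
  fixes d :: "'n::finite \<Rightarrow> nat"
  obtains k where "\<And>i. d i \<le> d k"
proof -
  have "Max (range d) \<in> range d" by (rule Max_in) auto
  then obtain k where "d k = Max (range d)" by (metis imageE)
  then have "d i \<le> d k" for i by simp
  then show ?thesis by (rule that)
qed

text \<open>Let \<open>k\<close> have maximal degree, and let \<open>?Q\<close> be the product and
  \<open>?R\<close> the sum of squares over the other indices. The difference in \<open>H\<close> is
  \<open>?R - p k * (?Q - p k)\<close>. If \<open>?Q - p k\<close> had degree at least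
  \<open>?d k\<close>, this would have degree at least \<open>2 * ?d k\<close>, since
  \<open>?R\<close> stays below that. But \<open>2 * ?d k \<ge> ?d k + ?E\<close>, which exceeds
  \<open>CARD('n)\<close> outside the case where all degrees are 1.\<close>

lemma markoff_degree_alternative:
  fixes p :: "'n::finite \<Rightarrow> complex poly"
  assumes card: "CARD('n) \<ge> 3"
    and deg: "\<And>i. degree (p i) \<ge> 1"
    and H: "degree ((\<Sum>i\<in>UNIV. (p i)\<^sup>2) - (\<Prod>i\<in>UNIV. p i)) \<le> CARD('n)"
  shows "(\<forall>i. degree (p i) = 1) \<or>
    (\<exists>k. degree ((\<Prod>j\<in>UNIV - {k}. p j) - p k) < degree (p k))"
proof -
  let ?d = "\<lambda>i. degree (p i)"
  have nz: "p i \<noteq> 0" for i using deg[of i] by auto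
  obtain k where k: "\<And>i. ?d i \<le> ?d k" by (rule exists_index_maximum[of ?d]) blast
  let ?E = "\<Sum>i\<in>UNIV - {k}. ?d i"
  let ?Q = "\<Prod>j\<in>UNIV - {k}. p j"
  let ?R = "\<Sum>j\<in>UNIV - {k}. (p j)\<^sup>2"
  have sum_k: "(\<Sum>i\<in>UNIV. ?d i) = ?d k + ?E"
    by (simp add: sum.remove[of UNIV k])
  have prod_k: "(\<Prod>i\<in>UNIV. p i) = p k * ?Q"
    by (simp add: prod.remove[of UNIV k])
  have squares_k: "(\<Sum>i\<in>UNIV. (p i)\<^sup>2) = (p k)\<^sup>2 + ?R"
    by (simp add: sum.remove[of UNIV k])
  have degQ: "degree ?Q = ?E"
    by (rule degree_prod_eq_sum_degree) (simp add: nz)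
  have degP: "degree (\<Prod>i\<in>UNIV. p i) = ?d k + ?E"
    unfolding sum_k[symmetric] by (rule degree_prod_eq_sum_degree) (simp add: nz)
  show ?thesis
  proof (cases "(\<Sum>i\<in>UNIV. ?d i) \<le> CARD('n)")
    case True
    have "?d i = 1" for i
    proof (rule ccontr)
      assume "?d i \<noteq> 1"
      then have "1 < ?d i" using deg[of i] by simp
      then have "(\<Sum>i\<in>(UNIV :: 'n set). 1) < (\<Sum>i\<in>UNIV. ?d i)"
        using deg by (intro sum_strict_mono_ex1) auto
      then show False using True by simp
    qed
    then show ?thesis by simp
  next
    case False
    then have big: "?d k + ?E > CARD('n)" by (simp add: sum_k)
    \<comment> \<open>Otherwise the product, of degree \<open>?d k + ?E > 2 * ?d k\<close>,
      dominates all squares and pushes the difference above degree \<open>CARD('n)\<close>.\<close>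
    have "?E \<le> ?d k"
    proof (rule ccontr)
      assume "\<not> ?thesis"
      moreover have "degree (\<Sum>i\<in>UNIV. (p i)\<^sup>2) \<le> 2 * ?d k"
        using k by (intro degree_sum_le order.trans[OF degree_power_le]) auto
      ultimately have "degree (\<Sum>i\<in>UNIV. (p i)\<^sup>2) < degree (- (\<Prod>i\<in>UNIV. p i))"
        using degP by simp
      from degree_add_eq_right[OF this] show False
        using H big degP by simp
    qed
    \<comment> \<open>Besides \<open>j\<close> there is at least one more index in
      \<open>?E\<close>, contributing at least 1; this is where three coordinates are
      needed.\<close>
    have strict: "?d j < ?d k" if "j \<noteq> k" for j
    proof -
      have "?E = ?d j + (\<Sum>i\<in>UNIV - {k} - {j}. ?d i)"
        using that by (intro sum.remove) auto
      moreover have "card (UNIV - {k} - {j}) \<le> (\<Sum>i\<in>UNIV - {k} - {j}. ?d i)"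
        using sum_mono[of "UNIV - {k} - {j}" "\<lambda>_. 1" ?d] deg by simp
      moreover have "card (UNIV - {k} - {j}) = CARD('n) - 2"
        using that by (simp add: card_Diff_subset)
      ultimately show ?thesis using card \<open>?E \<le> ?d k\<close> by simp
    qed
    have degR: "degree ?R < 2 * ?d k"
    proof -
      have "degree ((p j)\<^sup>2) \<le> 2 * ?d k - 1" if "j \<in> UNIV - {k}" for j
        using degree_power_le[of "p j" 2] strict[of j] that by auto
      then have "degree ?R \<le> 2 * ?d k - 1"
        by (intro degree_sum_le) auto
      then show ?thesis using deg[of k] by linarith
    qed
    have "degree (?Q - p k) < ?d k"
    proof (rule ccontr)
      assume not_less: "\<not> ?thesis"
      then have "?Q - p k \<noteq> 0" using deg[of k] by auto
      then have prod: "degree (- (p k * (?Q - p k))) = ?d k + degree (?Q - p k)"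
        using nz by (simp add: degree_mult_eq del: right_diff_distrib)
      with degR not_less have "degree ?R < degree (- (p k * (?Q - p k)))" by linarith
      from degree_add_eq_right[OF this]
      have "degree (?R + - (p k * (?Q - p k))) \<ge> 2 * ?d k"
        using prod not_less by linarith
      moreover have "?R + - (p k * (?Q - p k)) = (\<Sum>i\<in>UNIV. (p i)\<^sup>2) - (\<Prod>i\<in>UNIV. p i)"
        unfolding prod_k squares_k by (simp add: algebra_simps power2_eq_square)
      ultimately show False using H big \<open>?E \<le> ?d k\<close> by simp
    qed
    then show ?thesis by blast
  qed
qed

text \<open>The one-variable alternative is applied on a single line where all the degrees being
  compared are attained; there the polynomial \<open>?Q - p k\<close> is the restriction of the
  reflected coordinate.\<close>

lemma markoff_line_degree_alternative:
  fixes \<Theta> :: "complex ^ 'n::finite \<Rightarrow> complex ^ 'n"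
  assumes card: "CARD('n) \<ge> 3"
    and poly: "\<And>i. polynomial_function_complex (\<lambda>x. \<Theta> x $ i)"
    and H: "\<And>x. markoff_hurwitz (\<Theta> x) = markoff_hurwitz x"
    and surj: "surj \<Theta>" "\<And>k. surj (\<lambda>x. b_map k (\<Theta> x))"
  shows "(\<forall>i. line_degree (\<lambda>x. \<Theta> x $ i) = 1) \<or>
    (\<exists>k. line_degree (\<lambda>x. b_map k (\<Theta> x) $ k) < line_degree (\<lambda>x. \<Theta> x $ k))"
proof -
  \<comment> \<open>The sum type bundles both families, so that one direction \<open>v\<close>
    serves them all.\<close>
  define f where "f = case_sum (\<lambda>i x. \<Theta> x $ i) (\<lambda>k x. b_map k (\<Theta> x) $ k)"
  \<comment> \<open>A surjective map takes the values 0 and 1, which differ in every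
    coordinate.\<close>
  have nonconst: "\<exists>x y. F x $ i \<noteq> F y $ i" if F: "surj F" for F :: "complex ^ 'n \<Rightarrow> complex ^ 'n" and i
  proof -
    obtain x where x: "0 = F x" using surjD[OF F] ..
    obtain y where y: "1 = F y" using surjD[OF F] ..
    have "F x $ i \<noteq> F y $ i" by (simp flip: x y)
    then show ?thesis by (intro exI)
  qed
  have poly_f: "polynomial_function_complex (f s)" for s
    by (cases s) (auto simp: f_def b_map_def intro!: poly polynomial_function_complex_intros)
  have nonconst_f: "\<exists>x y. f s x \<noteq> f s y" for s
  proof (cases s)
    case (Inl i)
    then show ?thesis using nonconst[OF surj(1), of i] by (simp add: f_def)
  next
    case (Inr k)
    then show ?thesis using nonconst[OF surj(2), of k k] by (simp add: f_def)
  qed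
  have deg_f: "line_degree (f s) \<ge> 1" for s
  proof -
    obtain x y where "f s x \<noteq> f s y" using nonconst_f[of s] by (elim exE)
    then show ?thesis by (rule line_degree_pos[OF poly_f])
  qed
  obtain v where v: "\<And>s. degree (line_poly (f s) v) = line_degree (f s)"
    using line_degrees_attained_simultaneously[of UNIV f] poly_f deg_f by auto
  let ?p = "\<lambda>i. line_poly (\<lambda>x. \<Theta> x $ i) v"
  have p: "poly (?p i) t = \<Theta> (t *s v) $ i" for i t
    by (rule poly_line_poly[OF poly])
  have deg_p: "degree (?p i) = line_degree (\<lambda>x. \<Theta> x $ i)" for i
    using v[of "Inl i"] by (simp add: f_def)
  have reflected: "(\<Prod>j\<in>UNIV - {k}. ?p j) - ?p k = line_poly (\<lambda>x. b_map k (\<Theta> x) $ k) v" for k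
    by (rule line_poly_eqI[symmetric]) (simp add: p poly_prod b_map_def)
  have "(\<forall>i. degree (?p i) = 1) \<or> (\<exists>k. degree ((\<Prod>j\<in>UNIV - {k}. ?p j) - ?p k) < degree (?p k))"
  proof (rule markoff_degree_alternative[OF card])
    show "degree (?p i) \<ge> 1" for i
      using deg_f[of "Inl i"] by (simp add: deg_p f_def)
    have "(\<Sum>i\<in>UNIV. (?p i)\<^sup>2) - (\<Prod>i\<in>UNIV. ?p i) =
        monom (\<Sum>i\<in>UNIV. (v $ i)\<^sup>2) 2 - monom (\<Prod>i\<in>UNIV. v $ i) CARD('n)"
    proof (rule poly_ext)
      fix t
      show "poly ((\<Sum>i\<in>UNIV. (?p i)\<^sup>2) - (\<Prod>i\<in>UNIV. ?p i)) t =
        poly (monom (\<Sum>i\<in>UNIV. (v $ i)\<^sup>2) 2 - monom (\<Prod>i\<in>UNIV. v $ i) CARD('n)) t"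
        using H[of "t *s v"]
        by (simp add: markoff_hurwitz_def poly_sum poly_prod p poly_monom power_mult_distrib
            prod.distrib sum_distrib_left mult.commute)
    qed
    moreover have "degree (monom (\<Sum>i\<in>UNIV. (v $ i)\<^sup>2) 2 - monom (\<Prod>i\<in>UNIV. v $ i) CARD('n)) \<le> CARD('n)"
      using card by (intro degree_diff_le order.trans[OF degree_monom_le]) simp_all
    ultimately show "degree ((\<Sum>i\<in>UNIV. (?p i)\<^sup>2) - (\<Prod>i\<in>UNIV. ?p i)) \<le> CARD('n)"
      by simp
  qed
  moreover have "degree ((\<Prod>j\<in>UNIV - {k}. ?p j) - ?p k) = line_degree (\<lambda>x. b_map k (\<Theta> x) $ k)" for k
    using v[of "Inr k"] by (simp add: reflected f_def)
  ultimately show ?thesis by (simp add: deg_p)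
qed


section \<open>Affine maps preserving the Markoff-Hurwitz polynomial\<close>

text \<open>Some \<open>l i\<close> may be 0, so the degree is only bounded and the coefficient at
  \<open>card I\<close> need not be the leading one.\<close>

lemma coeff_prod_linear_factors:
  fixes c l :: "'i \<Rightarrow> 'a::comm_ring_1"
  assumes "finite I"
  shows "degree (\<Prod>i\<in>I. [:c i, l i:]) \<le> card I \<and>
    coeff (\<Prod>i\<in>I. [:c i, l i:]) (card I) = (\<Prod>i\<in>I. l i)"
  using assms
proof (induction I rule: finite_induct)
  case empty
  then show ?case by simp
next
  case (insert k I)
  let ?P = "\<Prod>i\<in>I. [:c i, l i:]"
  have "coeff ?P (Suc (card I)) = 0"
    using insert.IH by (intro coeff_eq_0) simp
  moreover have "degree ([:c k, l k:] * ?P) \<le> Suc (card I)"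
    using degree_mult_le[of "[:c k, l k:]" ?P] insert.IH degree_pCons_le[of "c k" "[:l k:]"] by auto
  ultimately show ?case using insert by simp
qed

lemma prod_signs:
  fixes \<epsilon> :: "'n::finite \<Rightarrow> complex"
  assumes "\<And>i. \<epsilon> i \<in> {1, -1}"
  shows "(\<Prod>i\<in>UNIV. \<epsilon> i) = 1 \<longleftrightarrow> even (card {i. \<epsilon> i = -1})"
proof -
  have "(\<Prod>i\<in>UNIV. \<epsilon> i) = (\<Prod>i\<in>UNIV. if \<epsilon> i = -1 then -1 else 1)"
    using assms by (intro prod.cong) auto
  also have "\<dots> = (-1) ^ card {i. \<epsilon> i = -1}"
    by (simp add: prod.If_cases)
  finally show ?thesis
    by (auto simp: minus_one_power_iff)
qed

lemma exists_two_other_indices: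
  fixes i :: "'n::finite"
  assumes "CARD('n) \<ge> 3"
  obtains j k where "j \<noteq> i" "k \<noteq> i" "j \<noteq> k"
proof -
  have "card (UNIV - {i}) \<ge> 2" using assms by simp
  then obtain T where "T \<subseteq> UNIV - {i}" "card T = 2" by (meson obtain_subset_with_card_n)
  then show ?thesis using that by (auto simp: card_2_iff)
qed

text \<open>Compare the coefficients of \<open>t ^ n\<close> in
  \<open>H (\<Theta> (t *s v)) = H (t *s v)\<close>. The squares reach degree 2 only, which is less
  than \<open>n\<close>.\<close>

lemma affine_linear_parts_prod:
  fixes \<Theta> :: "complex ^ 'n::finite \<Rightarrow> complex ^ 'n"
  assumes card: "CARD('n) \<ge> 3"
    and \<Theta>: "\<And>x i. \<Theta> x $ i = c i + (\<Sum>j\<in>UNIV. A i j * x $ j)"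
    and H: "\<And>x. markoff_hurwitz (\<Theta> x) = markoff_hurwitz x"
  shows "(\<Prod>i\<in>UNIV. \<Sum>j\<in>UNIV. A i j * v $ j) = (\<Prod>i\<in>UNIV. v $ i)"
proof -
  let ?L = "\<lambda>i. \<Sum>j\<in>UNIV. A i j * v $ j"
  let ?S = "\<Sum>i\<in>UNIV. [:c i, ?L i:]\<^sup>2" and ?P = "\<Prod>i\<in>UNIV. [:c i, ?L i:]"
  have "?S - ?P = monom (\<Sum>i\<in>UNIV. (v $ i)\<^sup>2) 2 - monom (\<Prod>i\<in>UNIV. v $ i) CARD('n)"
  proof (rule poly_ext)
    fix t
    show "poly (?S - ?P) t =
        poly (monom (\<Sum>i\<in>UNIV. (v $ i)\<^sup>2) 2 - monom (\<Prod>i\<in>UNIV. v $ i) CARD('n)) t"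
      using H[of "t *s v"]
      by (simp add: markoff_hurwitz_def poly_sum poly_prod \<Theta> poly_monom power_mult_distrib
            prod.distrib sum_distrib_left ac_simps)
  qed
  then have "coeff (?S - ?P) CARD('n) =
      coeff (monom (\<Sum>i\<in>UNIV. (v $ i)\<^sup>2) 2 - monom (\<Prod>i\<in>UNIV. v $ i) CARD('n)) CARD('n)"
    by simp
  moreover have "degree ?S \<le> 2"
  proof (intro degree_sum_le)
    fix i
    show "degree ([:c i, ?L i:]\<^sup>2) \<le> 2"
      using degree_power_le[of "[:c i, ?L i:]" 2] degree_pCons_le[of "c i" "[:?L i:]"] by simp
  qed simp
  then have "coeff ?S CARD('n) = 0"
    using card by (intro coeff_eq_0) simp
  moreover have "coeff ?P CARD('n) = (\<Prod>i\<in>UNIV. ?L i)"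
    using coeff_prod_linear_factors[of UNIV c ?L] by simp
  ultimately show ?thesis using card by simp
qed

text \<open>A hyperplane contained in the union of the coordinate hyperplanes is one of them.\<close>

lemma linear_form_single_coefficient:
  fixes a :: "'n::finite \<Rightarrow> complex"
  assumes nonzero: "a j \<noteq> 0" "a k \<noteq> 0"
    and zeros: "\<And>v :: complex ^ 'n. (\<Sum>l\<in>UNIV. a l * v $ l) = 0 \<Longrightarrow> \<exists>l. v $ l = 0"
  shows "j = k"
proof (rule ccontr)
  assume "j \<noteq> k"
  define S where "S = (\<Sum>l\<in>UNIV - {j} - {k}. a l)"
  \<comment> \<open>The value \<open>- S / a j\<close> is excluded because it would make
    \<open>t\<close> zero; \<open>t\<close> itself is solved from the equation of the
    hyperplane.\<close>
  obtain s where s: "s \<notin> {0, - S / a j}"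
    using ex_new_if_finite[OF infinite_UNIV_char_0, of "{0, - S / a j}"] by blast
  define t where "t = - (a j * s + S) / a k"
  have "a j * s + S \<noteq> 0" using s nonzero(1) by (auto simp: field_simps add_eq_0_iff)
  then have "t \<noteq> 0" using nonzero(2) by (simp add: t_def neg_eq_iff_add_eq_0)
  define v :: "complex ^ 'n" where "v = (\<chi> l. if l = j then s else if l = k then t else 1)"
  have "(\<Sum>l\<in>UNIV. a l * v $ l) = a j * s + (a k * t + S)"
    using \<open>j \<noteq> k\<close> by (simp add: sum.remove[of UNIV j] sum.remove[of "UNIV - {j}" k] v_def S_def)
  also have "\<dots> = 0" using nonzero(2) by (simp add: t_def)
  finally have "\<exists>l. v $ l = 0" by (rule zeros)
  then show False using s \<open>t \<noteq> 0\<close> by (auto simp: v_def split: if_splits)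
qed

text \<open>Zero sets replace unique factorization: where one linear form vanishes, so does some
  coordinate, hence the form has a single nonzero coefficient.\<close>

lemma affine_part_monomial:
  fixes A :: "'n::finite \<Rightarrow> 'n \<Rightarrow> complex"
  assumes prod: "\<And>v :: complex ^ 'n. (\<Prod>i\<in>UNIV. \<Sum>j\<in>UNIV. A i j * v $ j) = (\<Prod>i\<in>UNIV. v $ i)"
  obtains a \<sigma> where "bij \<sigma>" "(\<Prod>i\<in>UNIV. a i) = 1"
    "\<And>i (v :: complex ^ 'n). (\<Sum>j\<in>UNIV. A i j * v $ j) = a i * v $ \<sigma> i"
proof -
  have "\<exists>j. A i j \<noteq> 0" for i
  proof (rule ccontr)
    assume "\<not> ?thesis"
    then have "(\<Sum>j\<in>UNIV. A i j * (1 :: complex ^ 'n) $ j) = 0" by simp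
    then have "(\<Prod>i\<in>UNIV. \<Sum>j\<in>UNIV. A i j * (1 :: complex ^ 'n) $ j) = 0"
      by (intro prod_zero) auto
    then show False by (simp only: prod) simp
  qed
  then obtain \<sigma> where \<sigma>: "\<And>i. A i (\<sigma> i) \<noteq> 0" by metis
  have unique: "j = \<sigma> i" if "A i j \<noteq> 0" for i j
  proof (rule linear_form_single_coefficient[OF that \<sigma>])
    fix v :: "complex ^ 'n"
    assume "(\<Sum>l\<in>UNIV. A i l * v $ l) = 0"
    then have "(\<Prod>i\<in>UNIV. \<Sum>j\<in>UNIV. A i j * v $ j) = 0"
      by (intro prod_zero) auto
    then show "\<exists>l. v $ l = 0" by (simp add: prod)
  qed
  define a where "a i = A i (\<sigma> i)" for i
  have L: "(\<Sum>j\<in>UNIV. A i j * v $ j) = a i * v $ \<sigma> i" for i and v :: "complex ^ 'n"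
  proof -
    have "(\<Sum>j\<in>UNIV. A i j * v $ j) = (\<Sum>j\<in>{\<sigma> i}. A i j * v $ j)"
      using unique by (intro sum.mono_neutral_right) auto
    then show ?thesis by (simp add: a_def)
  qed
  have one: "(\<Prod>i\<in>UNIV. a i) = 1"
    using prod[of 1] unfolding L by simp
  have "surj \<sigma>"
  proof (rule ccontr)
    assume "\<not> surj \<sigma>"
    then obtain j where j: "j \<notin> range \<sigma>" by blast
    \<comment> \<open>If \<open>\<sigma>\<close> missed \<open>j\<close>, setting coordinate
      \<open>j\<close> to 0 would kill the product of the coordinates but not the product of the
      forms.\<close>
    define v :: "complex ^ 'n" where "v = (\<chi> l. if l = j then 0 else 1)"
    have "v $ \<sigma> i = 1" for i using j by (auto simp: v_def)
    then have "(\<Prod>i\<in>UNIV. v $ i) = 1"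
      using prod[of v] one by (simp add: L)
    moreover have "(\<Prod>i\<in>UNIV. v $ i) = 0"
      by (rule prod_zero) (auto simp: v_def)
    ultimately show False by simp
  qed
  then have "bij \<sigma>" by (simp add: finite_UNIV_surj_inj bij_def)
  from that[OF this one L] show ?thesis .
qed

text \<open>The mixed second difference in two further coordinates kills the squares.\<close>

lemma translation_part_zero:
  fixes a c :: "'n::finite \<Rightarrow> complex"
  assumes card: "CARD('n) \<ge> 3"
    and eq: "\<And>u :: 'n \<Rightarrow> complex. (\<Sum>l\<in>UNIV. (u l)\<^sup>2) - (\<Prod>l\<in>UNIV. u l) =
      (\<Sum>l\<in>UNIV. ((u l - c l) / a l)\<^sup>2) - (\<Prod>l\<in>UNIV. u l - c l)"
  shows "c i = 0"
proof -
  obtain j k where jk: "j \<noteq> i" "k \<noteq> i" "j \<noteq> k" by (rule exists_two_other_indices[OF card])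
  \<comment> \<open>With entry \<open>c i\<close> at position \<open>i\<close> the translated
    product has a zero factor, while the plain product is \<open>s * t * c i\<close>.\<close>
  define u where "u s t l = (if l = j then s else if l = k then t else if l = i then c i else 1)"
    for s t l
  let ?R = "UNIV - {j} - {k}"
  have sum_u: "(\<Sum>l\<in>UNIV. h l (u s t l)) = h j s + (h k t + (\<Sum>l\<in>?R. h l (u 0 0 l)))"
    for h :: "'n \<Rightarrow> complex \<Rightarrow> complex" and s t
  proof -
    have "(\<Sum>l\<in>?R. h l (u s t l)) = (\<Sum>l\<in>?R. h l (u 0 0 l))"
      by (rule sum.cong) (auto simp: u_def)
    then show ?thesis
      using jk by (simp add: sum.remove[of UNIV j] sum.remove[of "UNIV - {j}" k] u_def)
  qed
  have prod_u: "(\<Prod>l\<in>UNIV. u s t l) = s * t * c i" for s t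
  proof -
    have "(\<Prod>l\<in>?R. u s t l) = c i * (\<Prod>l\<in>?R - {i}. u s t l)"
      using jk by (subst prod.remove[of ?R i]) (auto simp: u_def)
    also have "(\<Prod>l\<in>?R - {i}. u s t l) = 1"
      by (rule prod.neutral) (auto simp: u_def)
    finally show ?thesis
      using jk by (simp add: prod.remove[of UNIV j] prod.remove[of "UNIV - {j}" k] u_def)
  qed
  have prod_uc: "(\<Prod>l\<in>UNIV. u s t l - c l) = 0" for s t
    using jk by (intro prod_zero) (auto simp: u_def intro!: exI[of _ i])
  define h where "h l z = ((z - c l) / a l)\<^sup>2" for l z
  have expand: "s\<^sup>2 + (t\<^sup>2 + (\<Sum>l\<in>?R. (u 0 0 l)\<^sup>2)) - s * t * c i =
      h j s + (h k t + (\<Sum>l\<in>?R. h l (u 0 0 l)))" for s t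
    using eq[of "u s t"] sum_u[where h = "\<lambda>l z. z\<^sup>2"] sum_u[where h = h]
    by (simp add: prod_u prod_uc flip: h_def)
  \<comment> \<open>In the alternating sum of the four corners of the unit square every term
    depending on only one of \<open>s\<close>, \<open>t\<close> cancels, which leaves
    \<open>c i = 0\<close>.\<close>
  show ?thesis
    using expand[of 0 0] expand[of 0 1] expand[of 1 0] expand[of 1 1] by algebra
qed

lemma affine_preserving_markoff:
  fixes \<Theta> :: "complex ^ 'n::finite \<Rightarrow> complex ^ 'n"
  assumes card: "CARD('n) \<ge> 3"
    and \<Theta>: "\<And>x i. \<Theta> x $ i = c i + (\<Sum>j\<in>UNIV. A i j * x $ j)"
    and H: "\<And>x. markoff_hurwitz (\<Theta> x) = markoff_hurwitz x"
  obtains \<epsilon> \<sigma> where "bij \<sigma>" "\<And>i. \<epsilon> i \<in> {1, -1}" "(\<Prod>i\<in>UNIV. \<epsilon> i) = 1"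
    "\<Theta> = sign_change \<epsilon> \<circ> permute_coords \<sigma>"
proof -
  obtain a \<sigma> where \<sigma>: "bij \<sigma>" and a: "(\<Prod>i\<in>UNIV. a i) = 1"
    and L: "\<And>i (v :: complex ^ 'n). (\<Sum>j\<in>UNIV. A i j * v $ j) = a i * v $ \<sigma> i"
    by (rule affine_part_monomial[OF affine_linear_parts_prod[OF card \<Theta> H]]) blast
  have \<Theta>': "\<Theta> x $ i = c i + a i * x $ \<sigma> i" for x i
    by (simp add: \<Theta> L)
  have a0: "a i \<noteq> 0" for i
    using a prod_zero[of UNIV a] by (metis UNIV_I finite zero_neq_one)
  \<comment> \<open>Invariance of \<open>H\<close>, read at the preimage of \<open>u\<close>; the
    denominators \<open>a l\<close> disappear from the product because they multiply to 1.\<close>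
  have eq: "(\<Sum>l\<in>UNIV. (u l)\<^sup>2) - (\<Prod>l\<in>UNIV. u l) =
      (\<Sum>l\<in>UNIV. ((u l - c l) / a l)\<^sup>2) - (\<Prod>l\<in>UNIV. u l - c l)" for u :: "'n \<Rightarrow> complex"
  proof -
    define x :: "complex ^ 'n" where "x = (\<chi> m. (u (inv_into UNIV \<sigma> m) - c (inv_into UNIV \<sigma> m)) / a (inv_into UNIV \<sigma> m))"
    have x: "x $ \<sigma> l = (u l - c l) / a l" for l
      using \<sigma> by (simp add: x_def bij_is_inj)
    then have "\<Theta> x $ l = u l" for l
      using a0[of l] by (simp add: \<Theta>')
    then have "(\<Sum>l\<in>UNIV. (u l)\<^sup>2) - (\<Prod>l\<in>UNIV. u l) = markoff_hurwitz x"
      using H[of x] by (simp add: markoff_hurwitz_def)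
    also have "\<dots> = (\<Sum>l\<in>UNIV. (x $ \<sigma> l)\<^sup>2) - (\<Prod>l\<in>UNIV. x $ \<sigma> l)"
      unfolding markoff_hurwitz_def
      using sum.reindex_bij_betw[OF \<sigma>, of "\<lambda>l. (x $ l)\<^sup>2"]
        prod.reindex_bij_betw[OF \<sigma>, of "\<lambda>l. x $ l"] by simp
    finally show ?thesis by (simp add: x prod_dividef a)
  qed
  have c: "c i = 0" for i
    by (rule translation_part_zero[OF card eq])
  \<comment> \<open>Take \<open>eq\<close> with zero translation at the \<open>i\<close>-th unit
    vector. Both products vanish there, since a second index exists.\<close>
  have sq: "(a i)\<^sup>2 = 1" for i
  proof -
    obtain j where "j \<noteq> i" by (rule exists_two_other_indices[OF card])
    then have "(\<Prod>l\<in>UNIV. if l = i then 1 else (0 :: complex)) = 0"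
      by (intro prod_zero) auto
    then have "1 = (1 / a i)\<^sup>2"
      using eq[of "\<lambda>l. if l = i then 1 else 0"]
      by (simp add: c if_distrib[of "\<lambda>z. z ^ 2"] if_distrib[of "\<lambda>z. z / _"] cong: if_cong)
    then show ?thesis by (simp add: power_divide)
  qed
  show ?thesis
  proof (rule that)
    \<comment> \<open>\<open>permute_coords\<close> reads coordinates through the inverse of its
      argument, so the inverse of \<open>\<sigma>\<close> has to be supplied.\<close>
    show "bij (inv_into UNIV \<sigma>)" using \<sigma> by (rule bij_imp_bij_inv)
    show "a i \<in> {1, -1}" for i using sq[of i] by (simp add: power2_eq_1_iff)
    show "(\<Prod>i\<in>UNIV. a i) = 1" by (rule a)
    show "\<Theta> = sign_change a \<circ> permute_coords (inv_into UNIV \<sigma>)"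
      using \<sigma> by (simp add: fun_eq_iff vec_eq_iff sign_change_def permute_coords_def \<Theta>' c
          inv_inv_eq)
  qed
qed


section \<open>Groups of transformations\<close>

lemma carrier_BijGroup_UNIV [simp]: "f \<in> carrier (BijGroup UNIV) \<longleftrightarrow> bij f"
  by (simp add: BijGroup_def Bij_def extensional_def)

lemma mult_BijGroup_UNIV:
  assumes "bij f" "bij g"
  shows "f \<otimes>\<^bsub>BijGroup UNIV\<^esub> g = f \<circ> g"
  using assms by (simp add: BijGroup_def Bij_def extensional_def compose_def o_def restrict_def)

lemma one_BijGroup_UNIV: "\<one>\<^bsub>BijGroup UNIV\<^esub> = id"
  by (simp add: BijGroup_def fun_eq_iff)

lemma inv_BijGroup_UNIV:
  assumes "bij f"
  shows "m_inv (BijGroup UNIV) f = inv_into UNIV f"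
  using assms by (subst inv_BijGroup) (simp_all add: Bij_def extensional_def restrict_def)

lemma subgroup_BijGroup_UNIV_I:
  assumes "\<And>f. f \<in> H \<Longrightarrow> bij f" "id \<in> H" "\<And>f g. f \<in> H \<Longrightarrow> g \<in> H \<Longrightarrow> f \<circ> g \<in> H"
    "\<And>f. f \<in> H \<Longrightarrow> inv_into UNIV f \<in> H"
  shows "subgroup H (BijGroup UNIV)"
  by (rule subgroup.intro)
    (use assms in \<open>auto simp: mult_BijGroup_UNIV one_BijGroup_UNIV inv_BijGroup_UNIV\<close>)

text \<open>Translates the abstract conditions into composition and inversion of functions, with all
  subgroups taken in the ambient group of bijections.\<close>

lemma semidirect_product_transformation_groupI:
  assumes sub: "subgroup G (BijGroup UNIV)" "subgroup N (BijGroup UNIV)" "subgroup K (BijGroup UNIV)"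
    and incl: "N \<subseteq> G" "K \<subseteq> G"
    and normal: "\<And>g h. g \<in> G \<Longrightarrow> h \<in> N \<Longrightarrow> g \<circ> h \<circ> inv_into UNIV g \<in> N"
    and trivial: "N \<inter> K \<subseteq> {id}"
    and factor: "\<And>g. g \<in> G \<Longrightarrow> \<exists>h\<in>N. \<exists>k\<in>K. g = h \<circ> k"
  shows "semidirect_product (transformation_group G) N K"
proof -
  note grp = group_BijGroup[of UNIV]
  have bij: "bij f" if "f \<in> G" for f
    using subgroup.mem_carrier[OF sub(1) that] by simp
  have N: "subgroup N (transformation_group G)" and K: "subgroup K (transformation_group G)"
    using group.subgroup_incl[OF grp] sub incl by blast+
  have inv: "m_inv (transformation_group G) f = inv_into UNIV f" if "f \<in> G" for f
    using group.m_inv_consistent[OF grp sub(1) that] inv_BijGroup_UNIV[OF bij[OF that]] by simp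
  have "N \<lhd> transformation_group G"
    unfolding group.normal_inv_iff[OF subgroup.subgroup_is_group[OF sub(1) grp]]
  proof (intro conjI ballI N)
    fix g h assume "g \<in> carrier (transformation_group G)" and h: "h \<in> N"
    then have g: "g \<in> G" by simp
    have "bij g" "bij h" "bij (inv_into UNIV g)" "bij (g \<circ> h)"
      using bij g h incl by (auto intro: bij_comp bij_imp_bij_inv)
    then show "g \<otimes>\<^bsub>transformation_group G\<^esub> h \<otimes>\<^bsub>transformation_group G\<^esub>
        inv\<^bsub>transformation_group G\<^esub> g \<in> N"
      using normal[OF g h] by (simp add: inv[OF g] mult_BijGroup_UNIV)
  qed
  moreover have "N \<inter> K = {\<one>\<^bsub>transformation_group G\<^esub>}"
    using trivial subgroup.one_closed[OF N] subgroup.one_closed[OF K]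
    by (auto simp: one_BijGroup_UNIV)
  moreover have "N <#>\<^bsub>transformation_group G\<^esub> K = carrier (transformation_group G)"
  proof -
    have mult: "h \<otimes>\<^bsub>transformation_group G\<^esub> k = h \<circ> k" if "h \<in> N" "k \<in> K" for h k
      using bij incl that by (simp add: mult_BijGroup_UNIV subset_iff)
    have "h \<circ> k \<in> G" if "h \<in> N" "k \<in> K" for h k
      using subgroup.m_closed[OF sub(1), of h k] incl that mult[OF that] by auto
    then show ?thesis
      using factor mult by (fastforce simp: set_mult_def)
  qed
  ultimately show ?thesis
    using K by (simp add: semidirect_product_def)
qed


section \<open>The reflections\<close>

lemma b_map_involution [simp]: "b_map i (b_map i x) = x"
proof -
  have "(\<Prod>j\<in>UNIV - {i}. b_map i x $ j) = (\<Prod>j\<in>UNIV - {i}. x $ j)"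
    by (rule prod.cong) (auto simp: b_map_def)
  then show ?thesis by (simp add: vec_eq_iff b_map_def[of i "b_map i x"]) (simp add: b_map_def)
qed

lemma b_map_comp_b_map [simp]: "b_map i \<circ> b_map i = id"
  by (simp add: fun_eq_iff)

lemma bij_b_map: "bij (b_map i)"
  using b_map_involution by (rule involuntory_imp_bij)

lemma inv_b_map: "inv_into UNIV (b_map i) = b_map i"
  by (rule inv_unique_comp) simp_all

text \<open>As a polynomial in \<open>x $ i\<close>, \<open>H\<close> is
  \<open>X\<^sup>2 - ?P * X + ?R\<close>. By Vieta the substitution of \<open>?P - X\<close> for
  \<open>X\<close> preserves it.\<close>

lemma markoff_hurwitz_b_map: "markoff_hurwitz (b_map i x) = markoff_hurwitz x"
proof -
  let ?P = "\<Prod>j\<in>UNIV - {i}. x $ j" and ?R = "\<Sum>j\<in>UNIV - {i}. (x $ j)\<^sup>2"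
  have "(\<Prod>j\<in>UNIV - {i}. b_map i x $ j) = ?P" "(\<Sum>j\<in>UNIV - {i}. (b_map i x $ j)\<^sup>2) = ?R"
    by (auto simp: b_map_def intro: prod.cong sum.cong)
  then have "markoff_hurwitz (b_map i x) = (?P - x $ i)\<^sup>2 + ?R - (?P - x $ i) * ?P"
    unfolding markoff_hurwitz_def
    by (simp add: sum.remove[of UNIV i] prod.remove[of UNIV i]) (simp add: b_map_def)
  also have "\<dots> = (x $ i)\<^sup>2 + ?R - x $ i * ?P"
    by (simp add: algebra_simps power2_eq_square)
  also have "\<dots> = markoff_hurwitz x"
    unfolding markoff_hurwitz_def by (simp add: sum.remove[of UNIV i] prod.remove[of UNIV i])
  finally show ?thesis .
qed

lemma polynomial_map_b_map: "polynomial_map (b_map i)"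
  unfolding polynomial_map_def
proof
  fix k
  show "polynomial_function_complex (\<lambda>x. b_map i x $ k)"
    by (cases "k = i") (simp_all add: b_map_def polynomial_function_complex_intros)
qed

text \<open>Inverse letters are unnecessary because each reflection is an involution; inversion is
  reversal of the word. The head of the list acts last.\<close>

definition b_word :: "'n::finite list \<Rightarrow> complex ^ 'n \<Rightarrow> complex ^ 'n" where
  "b_word w = foldr (\<lambda>i f. b_map i \<circ> f) w id"

lemma b_word_Nil [simp]: "b_word [] = id"
  by (simp add: b_word_def)

lemma b_word_Cons [simp]: "b_word (i # w) = b_map i \<circ> b_word w"
  by (simp add: b_word_def)

lemma b_word_append: "b_word (u @ v) = b_word u \<circ> b_word v"
  by (induction u) (simp_all add: o_assoc)

lemma b_word_cancel: "b_word (u @ [i, i] @ v) = b_word (u @ v)"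
  by (simp add: b_word_append fun_eq_iff)

lemma bij_b_word: "bij (b_word w)"
  by (induction w) (simp_all add: bij_b_map bij_comp del: id_apply o_apply)

lemma b_word_rev_comp: "b_word (rev w) \<circ> b_word w = id"
  by (induction w) (simp_all add: b_word_append fun_eq_iff)

lemma inv_b_word: "inv_into UNIV (b_word w) = b_word (rev w)"
  using b_word_rev_comp[of w] b_word_rev_comp[of "rev w"] by (intro inv_unique_comp) simp_all

lemma polynomial_map_id: "polynomial_map id"
  by (simp add: polynomial_map_def polynomial_function_complex_coord)

lemma polynomial_map_b_word: "polynomial_map (b_word w)"
  by (induction w)
    (simp_all add: polynomial_map_id polynomial_map_b_map polynomial_map_compose del: id_apply o_apply)

lemma markoff_hurwitz_b_word: "markoff_hurwitz (b_word w x) = markoff_hurwitz x"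
  by (induction w) (simp_all add: markoff_hurwitz_b_map)

lemma Gamma_group_eq_range_b_word: "Gamma_group = range b_word"
proof (intro Set.equalityI subsetI)
  fix f assume "f \<in> Gamma_group"
  then have "f \<in> generate (BijGroup UNIV) (range b_map)" by (simp add: Gamma_group_def)
  then show "f \<in> range b_word"
  proof (induction rule: generate.induct)
    case one
    show ?case by (rule range_eqI[of _ _ "[]"]) (simp add: one_BijGroup_UNIV)
  next
    case (incl h)
    then obtain i where "h = b_word [i]" by auto
    then show ?case by blast
  next
    case (inv h)
    then obtain i where "h = b_map i" by auto
    then have "m_inv (BijGroup UNIV) h = b_word [i]"
      by (simp add: inv_BijGroup_UNIV bij_b_map inv_b_map)
    then show ?case by blast
  next
    case (eng f g)
    then obtain u v where "f = b_word u" "g = b_word v" by auto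
    then have "f \<otimes>\<^bsub>BijGroup UNIV\<^esub> g = b_word (u @ v)"
      by (simp add: mult_BijGroup_UNIV bij_b_word b_word_append)
    then show ?case by blast
  qed
next
  fix f :: "complex ^ 'n \<Rightarrow> complex ^ 'n" assume "f \<in> range b_word"
  then obtain w where f: "f = b_word w" by blast
  have "b_word w \<in> generate (BijGroup UNIV) (range b_map)"
  proof (induction w)
    case Nil
    then show ?case using generate.one[of "BijGroup UNIV"] by (simp add: one_BijGroup_UNIV del: id_apply)
  next
    case (Cons i w)
    then have "b_map i \<otimes>\<^bsub>BijGroup UNIV\<^esub> b_word w \<in> generate (BijGroup UNIV) (range b_map)"
      by (intro generate.eng[OF generate.incl]) simp_all
    then show ?case by (simp add: mult_BijGroup_UNIV bij_b_map bij_b_word del: o_apply)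
  qed
  then show "f \<in> Gamma_group" by (simp add: f Gamma_group_def)
qed

lemma subgroup_Gamma_group: "subgroup Gamma_group (BijGroup UNIV)"
proof (rule subgroup_BijGroup_UNIV_I)
  show "id \<in> Gamma_group"
    unfolding Gamma_group_eq_range_b_word by (rule range_eqI[of _ _ "[]"]) simp
qed (auto simp: Gamma_group_eq_range_b_word bij_b_word inv_b_word simp flip: b_word_append)

section \<open>Reduced words and ping-pong\<close>

lemma not_distinct_adj_split:
  assumes "\<not> distinct_adj w"
  shows "\<exists>u i v. w = u @ [i, i] @ v"
  using assms
proof (induction w rule: induct_list012)
  case (3 x y zs)
  show ?case
  proof (cases "x = y")
    case True
    then have "x # y # zs = [] @ [x, x] @ zs" by simp
    then show ?thesis by blast
  next
    case False
    then obtain u i v where "y # zs = u @ [i, i] @ v" using 3 by auto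
    then have "x # y # zs = (x # u) @ [i, i] @ v" by simp
    then show ?thesis by blast
  qed
qed simp_all

lemma b_word_reduced: "\<exists>w'. distinct_adj w' \<and> b_word w' = b_word w"
proof (induction w rule: length_induct)
  case (1 w)
  show ?case
  proof (cases "distinct_adj w")
    case False
    then obtain u i v where w: "w = u @ [i, i] @ v" using not_distinct_adj_split by blast
    then have "\<exists>w'. distinct_adj w' \<and> b_word w' = b_word (u @ v)" using 1 by simp
    then show ?thesis by (simp only: w b_word_cancel)
  qed blast
qed

text \<open>The product over the indices other than \<open>j\<close> contains the maximum
  \<open>r i\<close> and a further factor \<open>r k \<ge> 3\<close>. The new entry is therefore at
  least \<open>3 * r i - r j \<ge> 2 * r i\<close>, larger than every old entry. The maximum in the
  hypothesis need not be strict, so the point with all entries 3 qualifies as a start.\<close>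

lemma b_map_ping_pong:
  fixes r :: "'n::finite \<Rightarrow> real"
  assumes card: "CARD('n) \<ge> 3" and "i \<noteq> j"
    and ge: "\<And>l. r l \<ge> 3" and max: "\<And>l. r l \<le> r i"
  shows "\<exists>r'. b_map j (\<chi> l. of_real (r l)) = (\<chi> l. of_real (r' l)) \<and> (\<forall>l. r' l \<ge> 3) \<and>
    (\<forall>l. l \<noteq> j \<longrightarrow> r' l < r' j)"
proof -
  let ?Q = "\<Prod>l\<in>UNIV - {j}. r l"
  define r' where "r' = r(j := ?Q - r j)"
  \<comment> \<open>Of two indices different from \<open>j\<close>, at least one also differs from
    \<open>i\<close>.\<close>
  obtain a b where "a \<noteq> j" "b \<noteq> j" "a \<noteq> b" by (rule exists_two_other_indices[OF card])
  then obtain k where k: "k \<noteq> j" "k \<noteq> i" by metis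
  have "?Q = r i * (r k * (\<Prod>l\<in>UNIV - {j} - {i} - {k}. r l))"
    using k \<open>i \<noteq> j\<close> by (simp add: prod.remove[of "UNIV - {j}" i] prod.remove[of "UNIV - {j} - {i}" k])
  moreover have "(\<Prod>l\<in>UNIV - {j} - {i} - {k}. r l) \<ge> 1"
    using ge by (intro prod_ge_1) (meson order.trans one_le_numeral)
  then have "r k * (\<Prod>l\<in>UNIV - {j} - {i} - {k}. r l) \<ge> 3 * 1"
    using ge[of k] by (intro mult_mono) simp_all
  then have "r i * (r k * (\<Prod>l\<in>UNIV - {j} - {i} - {k}. r l)) \<ge> r i * 3"
    using ge[of i] by (intro mult_left_mono) simp_all
  ultimately have new: "?Q - r j \<ge> 2 * r i"
    using max[of j] by simp
  have "b_map j (\<chi> l. of_real (r l)) = (\<chi> l. of_real (r' l))"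
    by (simp add: vec_eq_iff b_map_def r'_def)
  moreover have "r' l \<ge> 3" for l
    using new ge[of i] ge[of l] by (simp add: r'_def)
  moreover have "r' l < r' j" if "l \<noteq> j" for l
    using new ge[of i] max[of l] that by (simp add: r'_def)
  ultimately show ?thesis by blast
qed

lemma b_word_ping_pong:
  assumes card: "CARD('n::finite) \<ge> 3" and "distinct_adj (j # w)"
  shows "\<exists>r :: 'n \<Rightarrow> real. b_word (j # w) (\<chi> l. 3) = (\<chi> l. of_real (r l)) \<and> (\<forall>l. r l \<ge> 3) \<and>
    (\<forall>l. l \<noteq> j \<longrightarrow> r l < r j)"
  using assms(2)
proof (induction w arbitrary: j)
  case Nil
  obtain i where "i \<noteq> j" by (rule exists_two_other_indices[OF card])
  then show ?case using b_map_ping_pong[OF card, of i j "\<lambda>_. 3"] by simp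
next
  case (Cons i w)
  then obtain r :: "'n \<Rightarrow> real" where r: "b_word (i # w) (\<chi> l. 3) = (\<chi> l. of_real (r l))"
    "\<forall>l. r l \<ge> 3" "\<forall>l. l \<noteq> i \<longrightarrow> r l < r i"
    by (metis distinct_adj_Cons_Cons)
  have "r l \<le> r i" for l using r(3) by (cases "l = i") (auto intro: less_imp_le)
  moreover have "i \<noteq> j" using Cons.prems by auto
  ultimately have "\<exists>r'. b_map j (\<chi> l. of_real (r l)) = (\<chi> l. of_real (r' l)) \<and> (\<forall>l. r' l \<ge> 3) \<and>
      (\<forall>l. l \<noteq> j \<longrightarrow> r' l < r' j)"
    using r(2) by (intro b_map_ping_pong[OF card]) auto
  then show ?case using r(1) by simp
qed

text \<open>The strict maximum exceeds some other coordinate, which is itself at least 3. This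
  separates nonempty reduced words from the identity and from all signed permutations.\<close>

lemma b_word_large_coordinate:
  assumes card: "CARD('n::finite) \<ge> 3" and "distinct_adj w" "w \<noteq> []"
  shows "\<exists>j :: 'n. Re (b_word w (\<chi> l. 3) $ j) > 3"
proof -
  obtain j w' where w: "w = j # w'" using assms(3) by (cases w) auto
  obtain r :: "'n \<Rightarrow> real" where r: "b_word w (\<chi> l. 3) = (\<chi> l. of_real (r l))" "\<forall>l. r l \<ge> 3"
      "\<forall>l. l \<noteq> j \<longrightarrow> r l < r j"
    using b_word_ping_pong[OF card, of j w'] assms(2) w by blast
  obtain i where "i \<noteq> j" by (rule exists_two_other_indices[OF card])
  then have "3 < r j" using r(2,3) by (meson order.strict_trans1)
  then show ?thesis using r(1) by (intro exI[of _ j]) simp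
qed

lemma distinct_adj_b_word_eq_id:
  assumes "CARD('n::finite) \<ge> 3" "distinct_adj w" "b_word w = (id :: complex ^ 'n \<Rightarrow> _)"
  shows "w = []"
  using b_word_large_coordinate[OF assms(1,2)] assms(3) by auto


section \<open>The presentation\<close>

text \<open>Forgetting the exponent signs is harmless for involutions: a free cancellation becomes
  the deletion of a doubled letter.\<close>

lemma b_word_word_rel:
  assumes "(u, v) \<in> word_rel"
  shows "b_word (map fst u) = b_word (map fst v)"
proof -
  have cancels: "b_word (map fst u) = b_word (map fst v)" if "cancels u v" for u v :: "'n::finite word"
    using that by (cases rule: cancels.cases) (use b_word_cancel in simp)
  have "equivclp cancels u v" using assms by (simp add: word_rel_def)
  then show ?thesis
    by (induction rule: equivclp_induct) (auto dest: cancels)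
qed

text \<open>The homomorphism out of the free group, evaluated on an arbitrary representative; on
  classes the choice does not matter by \<open>b_word_word_rel\<close>.\<close>

definition b_eval :: "'n::finite word set \<Rightarrow> complex ^ 'n \<Rightarrow> complex ^ 'n" where
  "b_eval A = b_word (map fst (SOME u. u \<in> A))"

lemma b_eval_class: "b_eval (word_rel `` {u}) = b_word (map fst u)"
proof -
  have "u \<in> word_rel `` {u}" by (simp add: word_rel_def)
  then have "(SOME v. v \<in> word_rel `` {u}) \<in> word_rel `` {u}" by (rule someI)
  then have "(u, SOME v. v \<in> word_rel `` {u}) \<in> word_rel" by (rule ImageE) simp
  then show ?thesis unfolding b_eval_def by (rule b_word_word_rel[symmetric])
qed

lemma carrier_free_group: "carrier free_group = range (\<lambda>u. word_rel `` {u})"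
  by (auto simp: free_group_def quotient_def)

lemma one_free_group: "\<one>\<^bsub>free_group\<^esub> = word_rel `` {[]}"
  by (simp add: free_group_def)

lemma mult_Gamma_group:
  "b_word u \<otimes>\<^bsub>transformation_group Gamma_group\<^esub> b_word v = b_word (u @ v)"
  by (simp add: mult_BijGroup_UNIV bij_b_word b_word_append)

lemma b_eval_hom: "b_eval \<in> hom free_group (transformation_group Gamma_group)"
proof (rule homI)
  show "b_eval A \<in> carrier (transformation_group Gamma_group)" for A :: "'n::finite word set"
    by (simp add: Gamma_group_eq_range_b_word b_eval_def)
  fix A B :: "'n::finite word set"
  assume "A \<in> carrier free_group" "B \<in> carrier free_group"
  then obtain u v where "A = word_rel `` {u}" "B = word_rel `` {v}"
    by (auto simp: carrier_free_group)
  then show "b_eval (A \<otimes>\<^bsub>free_group\<^esub> B) =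
      b_eval A \<otimes>\<^bsub>transformation_group Gamma_group\<^esub> b_eval B"
    by (simp only: free_group_mult b_eval_class mult_Gamma_group map_append)
qed

text \<open>Inserts a relator in the middle of a word: \<open>u \<otimes> r \<otimes> v\<close> is a
  conjugate of \<open>r\<close> times \<open>u \<otimes> v\<close>.\<close>

lemma (in group) conj_mult_in_normal:
  assumes "N \<lhd> G" "r \<in> N" "u \<in> carrier G" "v \<in> carrier G" "u \<otimes> v \<in> N"
  shows "u \<otimes> r \<otimes> v \<in> N"
proof -
  have N: "subgroup N G" using assms(1) by (rule normal_imp_subgroup)
  have r: "r \<in> carrier G" by (rule subgroup.mem_carrier[OF N assms(2)])
  have "u \<otimes> r \<otimes> inv u \<in> N" by (rule normal.inv_op_closed2[OF assms(1,3,2)])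
  then have "(u \<otimes> r \<otimes> inv u) \<otimes> (u \<otimes> v) \<in> N"
    using assms(5) by (rule subgroup.m_closed[OF N])
  moreover have "(u \<otimes> r \<otimes> inv u) \<otimes> (u \<otimes> v) = u \<otimes> r \<otimes> v"
    using assms r by (simp add: m_assoc inv_solve_left')
  ultimately show ?thesis by simp
qed

lemma square_class_in_normal:
  assumes N: "N \<lhd> free_group" and gens: "free_gen i \<otimes>\<^bsub>free_group\<^esub> free_gen i \<in> N"
  shows "word_rel `` {[(i, s), (i, s)]} \<in> N"
proof (cases s)
  case True
  then show ?thesis using gens by (simp add: free_gen_def free_group_mult)
next
  case False
  let ?r = "word_rel `` {[(i, True), (i, True)]}"
  have r: "?r \<in> N" using gens by (simp add: free_gen_def free_group_mult)
  have "word_rel `` {[(i, False), (i, False)]} \<otimes>\<^bsub>free_group\<^esub> ?r = \<one>\<^bsub>free_group\<^esub>"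
    using equiv_class_eq[OF equiv_word_rel word_rel_inverse[of "[(i, True), (i, True)]"]]
    by (simp add: free_group_mult one_free_group)
  then have "inv\<^bsub>free_group\<^esub> ?r = word_rel `` {[(i, False), (i, False)]}"
    by (rule group.inv_equality[OF group_free_group]) (auto simp: carrier_free_group)
  then show ?thesis
    using False subgroup.m_inv_closed[OF normal_imp_subgroup[OF N] r] by simp
qed

text \<open>By ping-pong a nonempty word acting trivially has two adjacent letters with the same
  index. Opposite signs cancel freely, and equal signs form a square relator or its inverse, which
  is removed modulo \<open>N\<close>; the shorter word still acts trivially.\<close>

lemma b_word_eq_id_in_normal:
  assumes card: "CARD('n::finite) \<ge> 3" and N: "N \<lhd> free_group"
    and gens: "\<And>i :: 'n. free_gen i \<otimes>\<^bsub>free_group\<^esub> free_gen i \<in> N"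
    and "b_word (map fst w) = id"
  shows "word_rel `` {w} \<in> N"
  using assms(4)
proof (induction w rule: length_induct)
  case (1 w)
  have subgroup: "subgroup N free_group" by (rule normal_imp_subgroup[OF N])
  show ?case
  proof (cases "w = []")
    case True
    then show ?thesis
      using subgroup.one_closed[OF subgroup] by (simp add: one_free_group)
  next
    case False
    then have "\<not> distinct_adj (map fst w)"
      using distinct_adj_b_word_eq_id[OF card] 1(2) by blast
    then obtain u' i v' where "map fst w = u' @ [i, i] @ v'"
      using not_distinct_adj_split by blast
    then obtain u s t v where w: "w = u @ [(i, s), (i, t)] @ v"
      by (auto simp: map_eq_append_conv map_eq_Cons_conv)
    have "b_word (map fst w) = b_word (map fst (u @ v))"
      using b_word_cancel[of "map fst u" i "map fst v"] by (simp add: w)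
    then have "b_word (map fst (u @ v)) = id" using 1(2) by metis
    then have IH: "word_rel `` {u @ v} \<in> N"
      using 1(1) by (simp add: w)
    show ?thesis
    proof (cases "t = s")
      case True
      have "word_rel `` {u} \<otimes>\<^bsub>free_group\<^esub> word_rel `` {[(i, s), (i, s)]} \<otimes>\<^bsub>free_group\<^esub>
          word_rel `` {v} \<in> N"
        by (rule group.conj_mult_in_normal[OF group_free_group N square_class_in_normal[OF N gens]])
          (auto simp: carrier_free_group free_group_mult IH)
      then show ?thesis by (simp add: w True free_group_mult)
    next
      case False
      then have "t = (\<not> s)" by simp
      then have "cancels w (u @ v)" using cancels.intros[of u i s v] by (simp add: w)
      then have "(w, u @ v) \<in> word_rel" by (auto simp: word_rel_def)
      then show ?thesis using equiv_class_eq[OF equiv_word_rel] IH by metis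
    qed
  qed
qed

lemma has_presentation_Gamma_group:
  assumes card: "CARD('n::finite) \<ge> 3"
  shows "has_presentation (transformation_group Gamma_group) (b_map :: 'n \<Rightarrow> complex ^ 'n \<Rightarrow> complex ^ 'n)
    {free_gen i \<otimes>\<^bsub>free_group\<^esub> free_gen i | i. True}"
    (is "has_presentation ?G _ ?R")
proof -
  have grp: "group ?G"
    by (rule subgroup.subgroup_is_group[OF subgroup_Gamma_group group_BijGroup])
  interpret group_hom free_group ?G b_eval
    by (intro group_hom.intro group_hom_axioms.intro group_free_group grp b_eval_hom)
  have onto: "b_eval ` carrier free_group = carrier ?G"
  proof -
    \<comment> \<open>Positive letters suffice for surjectivity, again because the generators are
      involutions.\<close>
    have "b_word w = b_eval (word_rel `` {map (\<lambda>i. (i, True)) w})" for w :: "'n list"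
      by (simp add: b_eval_class o_def)
    then have "carrier ?G \<subseteq> b_eval ` carrier free_group"
      by (auto simp: Gamma_group_eq_range_b_word carrier_free_group)
    then show ?thesis using hom_closed by blast
  qed
  have mem_kernel: "word_rel `` {w} \<in> kernel free_group ?G b_eval \<longleftrightarrow> b_word (map fst w) = id" for w
    by (simp add: kernel_def carrier_free_group b_eval_class one_BijGroup_UNIV)
  have "kernel free_group ?G b_eval \<subseteq> normal_closure free_group ?R"
  proof
    fix A assume A: "A \<in> kernel free_group ?G b_eval"
    then obtain w where w: "A = word_rel `` {w}" by (auto simp: kernel_def carrier_free_group)
    then have "b_word (map fst w) = id" using A mem_kernel by blast
    then show "A \<in> normal_closure free_group ?R"
      unfolding normal_closure_def w
      by (auto intro!: b_word_eq_id_in_normal[OF card])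
  qed
  moreover have "?R \<subseteq> kernel free_group ?G b_eval"
    by (auto simp: free_gen_def free_group_mult mem_kernel)
  then have "normal_closure free_group ?R \<subseteq> kernel free_group ?G b_eval"
    unfolding normal_closure_def using normal_kernel by blast
  ultimately show ?thesis
    unfolding has_presentation_def
    using grp b_eval_hom onto by (auto simp: free_gen_def b_eval_class intro!: bexI[of _ b_eval])
qed


section \<open>Sign changes and permutations of the coordinates\<close>

text \<open>Parity of the number of minus signs, expressed as a product because this form is visibly
  closed under multiplication and permutation.\<close>

definition even_signs :: "('n::finite \<Rightarrow> complex) \<Rightarrow> bool" where
  "even_signs \<epsilon> \<longleftrightarrow> (\<forall>i. \<epsilon> i \<in> {1, -1}) \<and> (\<Prod>i\<in>UNIV. \<epsilon> i) = 1"

lemma Upsilon_eq: "Upsilon = sign_change ` {\<epsilon>. even_signs \<epsilon>}"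
  unfolding Upsilon_def even_signs_def using prod_signs by blast

lemma even_signs_square: "even_signs \<epsilon> \<Longrightarrow> \<epsilon> i * \<epsilon> i = 1"
  unfolding even_signs_def by (metis insertE minus_mult_minus mult_1 singletonD)

lemma even_signs_one: "even_signs (\<lambda>i. 1)"
  by (simp add: even_signs_def)

lemma even_signs_mult:
  assumes "even_signs \<epsilon>" "even_signs \<delta>"
  shows "even_signs (\<lambda>i. \<epsilon> i * \<delta> i)"
proof -
  have "\<epsilon> i * \<delta> i \<in> {1, -1}" for i
    using assms unfolding even_signs_def
    by (metis insertCI insertE minus_mult_minus mult.right_neutral mult_1 singletonD)
  then show ?thesis using assms by (simp add: even_signs_def prod.distrib)
qed

lemma even_signs_permute:
  assumes "even_signs \<epsilon>" "bij \<sigma>"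
  shows "even_signs (\<lambda>i. \<epsilon> (\<sigma> i))"
  using assms(1) prod.reindex_bij_betw[OF assms(2), of \<epsilon>] by (simp add: even_signs_def)

lemma sign_change_comp: "sign_change \<epsilon> \<circ> sign_change \<delta> = sign_change (\<lambda>i. \<epsilon> i * \<delta> i)"
  by (simp add: fun_eq_iff vec_eq_iff sign_change_def mult.assoc)

lemma sign_change_one: "sign_change (\<lambda>i. 1) = id"
  by (simp add: fun_eq_iff vec_eq_iff sign_change_def)

lemma sign_change_involution: "even_signs \<epsilon> \<Longrightarrow> sign_change \<epsilon> \<circ> sign_change \<epsilon> = id"
  by (simp add: sign_change_comp even_signs_square sign_change_one)

lemma bij_sign_change: "even_signs \<epsilon> \<Longrightarrow> bij (sign_change \<epsilon>)"
  using sign_change_involution by (metis o_bij)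

lemma inv_sign_change: "even_signs \<epsilon> \<Longrightarrow> inv_into UNIV (sign_change \<epsilon>) = sign_change \<epsilon>"
  using sign_change_involution by (intro inv_unique_comp)

lemma permute_coords_id: "permute_coords id = id"
  by (simp add: fun_eq_iff vec_eq_iff permute_coords_def)

lemma permute_coords_comp:
  assumes "bij \<sigma>" "bij \<tau>"
  shows "permute_coords (\<sigma> \<circ> \<tau>) = permute_coords \<sigma> \<circ> permute_coords \<tau>"
  using assms by (simp add: fun_eq_iff vec_eq_iff permute_coords_def o_inv_distrib)

lemma permute_coords_inv_comp:
  assumes "bij \<sigma>"
  shows "permute_coords (inv_into UNIV \<sigma>) \<circ> permute_coords \<sigma> = id"
    and "permute_coords \<sigma> \<circ> permute_coords (inv_into UNIV \<sigma>) = id"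
proof -
  have "inv_into UNIV \<sigma> \<circ> \<sigma> = id" "\<sigma> \<circ> inv_into UNIV \<sigma> = id"
    using assms by (simp_all add: bij_is_inj bij_is_surj surj_iff[THEN iffD1])
  then show "permute_coords (inv_into UNIV \<sigma>) \<circ> permute_coords \<sigma> = id"
      "permute_coords \<sigma> \<circ> permute_coords (inv_into UNIV \<sigma>) = id"
    using permute_coords_comp[OF assms bij_imp_bij_inv[OF assms]]
      permute_coords_comp[OF bij_imp_bij_inv[OF assms] assms] permute_coords_id by metis+
qed

lemma bij_permute_coords: "bij \<sigma> \<Longrightarrow> bij (permute_coords \<sigma>)"
  using permute_coords_inv_comp by (metis o_bij)

lemma inv_permute_coords:
  "bij \<sigma> \<Longrightarrow> inv_into UNIV (permute_coords \<sigma>) = permute_coords (inv_into UNIV \<sigma>)"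
  using permute_coords_inv_comp by (intro inv_unique_comp)

text \<open>Moving a permutation past a sign change only relabels the signs; this underlies closure
  under composition and the normality of \<open>Upsilon\<close>.\<close>

lemma permute_coords_comp_sign_change:
  "permute_coords \<sigma> \<circ> sign_change \<epsilon> = sign_change (\<lambda>i. \<epsilon> (inv_into UNIV \<sigma> i)) \<circ> permute_coords \<sigma>"
  by (simp add: fun_eq_iff vec_eq_iff sign_change_def permute_coords_def)

text \<open>The explicit form that \<open>Lambda\<close> turns out to have for
  \<open>n \<ge> 3\<close>; the group theory is done with this set, and \<open>Lambda\<close> is
  substituted at the end.\<close>

definition signed_permutations :: "(complex ^ 'n::finite \<Rightarrow> complex ^ 'n) set" where
  "signed_permutations = {sign_change \<epsilon> \<circ> permute_coords \<sigma> | \<epsilon> \<sigma>. even_signs \<epsilon> \<and> bij \<sigma>}"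

lemma signed_permutations_comp:
  assumes "f \<in> signed_permutations" "g \<in> signed_permutations"
  shows "f \<circ> g \<in> signed_permutations"
proof -
  obtain \<epsilon> \<sigma> \<delta> \<tau> where f: "f = sign_change \<epsilon> \<circ> permute_coords \<sigma>" "even_signs \<epsilon>" "bij \<sigma>"
    and g: "g = sign_change \<delta> \<circ> permute_coords \<tau>" "even_signs \<delta>" "bij \<tau>"
    using assms by (auto simp: signed_permutations_def)
  have "f \<circ> g = sign_change \<epsilon> \<circ> (permute_coords \<sigma> \<circ> sign_change \<delta>) \<circ> permute_coords \<tau>"
    by (simp add: f g o_assoc)
  also have "\<dots> = (sign_change \<epsilon> \<circ> sign_change (\<lambda>i. \<delta> (inv_into UNIV \<sigma> i))) \<circ>
      (permute_coords \<sigma> \<circ> permute_coords \<tau>)"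
    by (simp only: permute_coords_comp_sign_change o_assoc)
  also have "\<dots> = sign_change (\<lambda>i. \<epsilon> i * \<delta> (inv_into UNIV \<sigma> i)) \<circ> permute_coords (\<sigma> \<circ> \<tau>)"
    using f g by (simp only: sign_change_comp permute_coords_comp)
  finally show ?thesis
    unfolding signed_permutations_def
    using even_signs_mult[OF f(2) even_signs_permute[OF g(2) bij_imp_bij_inv[OF f(3)]]]
      bij_comp[OF g(3) f(3)] by blast
qed

lemma sign_change_in_signed_permutations: "even_signs \<epsilon> \<Longrightarrow> sign_change \<epsilon> \<in> signed_permutations"
  unfolding signed_permutations_def
  by (auto intro!: exI[of _ \<epsilon>] exI[of _ id] simp: permute_coords_id)

lemma permute_coords_in_signed_permutations: "bij \<sigma> \<Longrightarrow> permute_coords \<sigma> \<in> signed_permutations"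
  unfolding signed_permutations_def
  by (auto intro!: exI[of _ "\<lambda>_. 1"] exI[of _ \<sigma>] simp: sign_change_one even_signs_one)

lemma bij_signed_permutation: "f \<in> signed_permutations \<Longrightarrow> bij f"
  by (auto simp: signed_permutations_def intro: bij_comp bij_sign_change bij_permute_coords)

lemma inv_signed_permutation:
  assumes "f \<in> signed_permutations"
  shows "inv_into UNIV f \<in> signed_permutations"
proof -
  obtain \<epsilon> \<sigma> where f: "f = sign_change \<epsilon> \<circ> permute_coords \<sigma>" "even_signs \<epsilon>" "bij \<sigma>"
    using assms by (auto simp: signed_permutations_def)
  have "inv_into UNIV f = permute_coords (inv_into UNIV \<sigma>) \<circ> sign_change \<epsilon>"
    unfolding f(1) using f(2,3)
    by (simp add: o_inv_distrib bij_sign_change bij_permute_coords inv_sign_change inv_permute_coords)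
  then show ?thesis
    using f(2,3) by (simp add: signed_permutations_comp sign_change_in_signed_permutations
        permute_coords_in_signed_permutations bij_imp_bij_inv)
qed

lemma subgroup_signed_permutations: "subgroup signed_permutations (BijGroup UNIV)"
  using sign_change_in_signed_permutations[OF even_signs_one]
  by (intro subgroup_BijGroup_UNIV_I)
    (simp_all add: bij_signed_permutation signed_permutations_comp inv_signed_permutation sign_change_one)

lemma subgroup_Upsilon: "subgroup Upsilon (BijGroup UNIV)"
proof (rule subgroup_BijGroup_UNIV_I)
  show "id \<in> (Upsilon :: (complex ^ 'n::finite \<Rightarrow> _) set)"
    unfolding Upsilon_eq sign_change_one[symmetric] using even_signs_one by blast
qed (auto simp: Upsilon_eq bij_sign_change inv_sign_change sign_change_comp intro: even_signs_mult)

lemma subgroup_Perms: "subgroup Perms (BijGroup UNIV)"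
proof (rule subgroup_BijGroup_UNIV_I)
  show "id \<in> (Perms :: (complex ^ 'n::finite \<Rightarrow> _) set)"
    unfolding Perms_def permute_coords_id[symmetric] by blast
qed (auto simp: Perms_def bij_permute_coords inv_permute_coords bij_comp bij_imp_bij_inv
    simp flip: permute_coords_comp)

lemma markoff_hurwitz_signed_permutation:
  assumes "f \<in> signed_permutations"
  shows "markoff_hurwitz (f x) = markoff_hurwitz x"
proof -
  obtain \<epsilon> \<sigma> where f: "f = sign_change \<epsilon> \<circ> permute_coords \<sigma>" "even_signs \<epsilon>" "bij \<sigma>"
    using assms by (auto simp: signed_permutations_def)
  let ?\<tau> = "inv_into UNIV \<sigma>"
  have \<tau>: "bij ?\<tau>" using f(3) by (rule bij_imp_bij_inv)
  have coord: "f x $ i = \<epsilon> i * x $ ?\<tau> i" for i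
    by (simp add: f sign_change_def permute_coords_def)
  have "(f x $ i)\<^sup>2 = (x $ ?\<tau> i)\<^sup>2" for i
    using even_signs_square[OF f(2), of i]
    by (simp add: coord power_mult_distrib) (simp add: power2_eq_square)
  moreover have "(\<Prod>i\<in>UNIV. f x $ i) = (\<Prod>i\<in>UNIV. x $ ?\<tau> i)"
    using f(2) by (simp add: coord prod.distrib even_signs_def)
  ultimately show ?thesis
    using sum.reindex_bij_betw[OF \<tau>, of "\<lambda>i. (x $ i)\<^sup>2"] prod.reindex_bij_betw[OF \<tau>, of "\<lambda>i. x $ i"]
    by (simp add: markoff_hurwitz_def)
qed

lemma linear_signed_permutation:
  assumes "f \<in> signed_permutations"
  shows "Vector_Spaces.linear (*s) (*s) f"
proof -
  obtain \<epsilon> \<sigma> where f: "f = sign_change \<epsilon> \<circ> permute_coords \<sigma>"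
    using assms by (auto simp: signed_permutations_def)
  show ?thesis
    unfolding f
    by unfold_locales
      (simp_all add: vec_eq_iff sign_change_def permute_coords_def algebra_simps)
qed

section \<open>Linear automorphisms as signed permutations\<close>

lemma linear_coordinates:
  fixes \<Theta> :: "complex ^ 'n::finite \<Rightarrow> complex ^ 'n"
  assumes "Vector_Spaces.linear (*s) (*s) \<Theta>"
  shows "\<Theta> x $ i = 0 + (\<Sum>j\<in>UNIV. \<Theta> (axis j 1) $ i * x $ j)"
proof -
  \<comment> \<open>The summand 0 in the claim is the translation part, so that the result on affine
    maps applies directly.\<close>
  interpret Vector_Spaces.linear "(*s)" "(*s)" \<Theta> by (rule assms)
  have "\<Theta> x = \<Theta> (\<Sum>j\<in>UNIV. x $ j *s axis j 1)"
    by (simp add: basis_expansion)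
  also have "\<dots> = (\<Sum>j\<in>UNIV. x $ j *s \<Theta> (axis j 1))"
    by (simp add: sum scale)
  finally show ?thesis by (simp add: mult.commute)
qed

lemma affine_preserving_in_signed_permutations:
  fixes \<Theta> :: "complex ^ 'n::finite \<Rightarrow> complex ^ 'n"
  assumes card: "CARD('n) \<ge> 3"
    and \<Theta>: "\<And>x i. \<Theta> x $ i = c i + (\<Sum>j\<in>UNIV. A i j * x $ j)"
    and H: "\<And>x. markoff_hurwitz (\<Theta> x) = markoff_hurwitz x"
  shows "\<Theta> \<in> signed_permutations"
  by (rule affine_preserving_markoff[OF assms])
    (auto simp: signed_permutations_def even_signs_def)

lemma preserves_markoff_hurwitz_iff:
  "preserves f markoff_hurwitz \<longleftrightarrow> (\<forall>x. markoff_hurwitz (f x) = markoff_hurwitz x)"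
  by (simp add: preserves_def fun_eq_iff)

lemma Lambda_eq_signed_permutations:
  assumes card: "CARD('n::finite) \<ge> 3"
  shows "(Lambda :: (complex ^ 'n \<Rightarrow> complex ^ 'n) set) = signed_permutations"
proof (intro Set.equalityI subsetI)
  fix f :: "complex ^ 'n \<Rightarrow> complex ^ 'n" assume "f \<in> Lambda"
  then show "f \<in> signed_permutations"
    by (intro affine_preserving_in_signed_permutations[OF card linear_coordinates])
      (simp_all add: Lambda_def linear_automorphism_def preserves_markoff_hurwitz_iff)
next
  fix f :: "complex ^ 'n \<Rightarrow> complex ^ 'n" assume "f \<in> signed_permutations"
  then show "f \<in> Lambda"
    by (simp add: Lambda_def linear_automorphism_def bij_signed_permutation
        linear_signed_permutation preserves_markoff_hurwitz_iff markoff_hurwitz_signed_permutation)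
qed

lemma finite_signed_permutations:
  "finite (signed_permutations :: (complex ^ 'n::finite \<Rightarrow> complex ^ 'n) set)"
proof -
  have "{\<epsilon> :: 'n \<Rightarrow> complex. even_signs \<epsilon>} \<subseteq> (\<Pi>\<^sub>E i\<in>UNIV. {1, -1})"
    by (auto simp: even_signs_def)
  then have "finite {\<epsilon> :: 'n \<Rightarrow> complex. even_signs \<epsilon>}"
    by (rule finite_subset) (simp add: finite_PiE)
  moreover have "signed_permutations \<subseteq>
      (\<lambda>(\<epsilon>, \<sigma>). sign_change \<epsilon> \<circ> permute_coords \<sigma>) ` ({\<epsilon> :: 'n \<Rightarrow> complex. even_signs \<epsilon>} \<times> UNIV)"
    by (auto simp: signed_permutations_def)
  ultimately show ?thesis
    by (meson finite_SigmaI finite finite_imageI finite_subset)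
qed

lemma semidirect_product_signed_permutations:
  "semidirect_product (transformation_group signed_permutations) Upsilon
    (Perms :: (complex ^ 'n::finite \<Rightarrow> complex ^ 'n) set)"
proof (rule semidirect_product_transformation_groupI)
  show "Upsilon \<subseteq> (signed_permutations :: (complex ^ 'n \<Rightarrow> _) set)"
    by (auto simp: Upsilon_eq sign_change_in_signed_permutations)
  show "Perms \<subseteq> (signed_permutations :: (complex ^ 'n \<Rightarrow> _) set)"
    by (auto simp: Perms_def permute_coords_in_signed_permutations)
  show "Upsilon \<inter> Perms \<subseteq> {id :: complex ^ 'n \<Rightarrow> _}"
  proof
    fix f :: "complex ^ 'n \<Rightarrow> complex ^ 'n" assume "f \<in> Upsilon \<inter> Perms"
    then obtain \<epsilon> \<sigma> where f: "f = sign_change \<epsilon>" "f = permute_coords \<sigma>"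
      unfolding Upsilon_eq Perms_def by blast
    \<comment> \<open>The all-ones vector is fixed by permutations and displays the signs of a sign
      change.\<close>
    have "\<epsilon> i = f 1 $ i" for i by (simp add: f(1) sign_change_def)
    also have "f 1 $ i = 1" for i by (simp add: f(2) permute_coords_def)
    finally have "\<epsilon> = (\<lambda>i. 1)" by auto
    then show "f \<in> {id}" by (simp add: f(1) sign_change_one)
  qed
  show "\<exists>h\<in>Upsilon. \<exists>k\<in>Perms. g = h \<circ> k" if "g \<in> signed_permutations"
    for g :: "complex ^ 'n \<Rightarrow> complex ^ 'n"
    using that by (auto simp: signed_permutations_def Upsilon_eq Perms_def)
  fix g h :: "complex ^ 'n \<Rightarrow> complex ^ 'n" assume "g \<in> signed_permutations" "h \<in> Upsilon"
  then obtain \<epsilon> \<sigma> \<delta> where g: "g = sign_change \<epsilon> \<circ> permute_coords \<sigma>" "even_signs \<epsilon>" "bij \<sigma>"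
    and h: "h = sign_change \<delta>" "even_signs \<delta>"
    by (auto simp: signed_permutations_def Upsilon_eq)
  let ?\<delta> = "\<lambda>i. \<delta> (inv_into UNIV \<sigma> i)"
  have "g \<circ> h = sign_change ?\<delta> \<circ> g"
  proof -
    have "g \<circ> h = sign_change \<epsilon> \<circ> (permute_coords \<sigma> \<circ> sign_change \<delta>)"
      by (simp add: g h o_assoc)
    also have "\<dots> = (sign_change \<epsilon> \<circ> sign_change ?\<delta>) \<circ> permute_coords \<sigma>"
      by (simp only: permute_coords_comp_sign_change o_assoc)
    \<comment> \<open>Sign changes commute, so only the permutation part of \<open>g\<close> acts on
      \<open>\<delta>\<close> by conjugation.\<close>
    also have "\<dots> = (sign_change ?\<delta> \<circ> sign_change \<epsilon>) \<circ> permute_coords \<sigma>"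
      by (simp only: sign_change_comp mult.commute)
    finally show ?thesis by (simp only: g o_assoc)
  qed
  moreover have "bij g"
    unfolding g(1) using g(2,3) by (intro bij_comp bij_sign_change bij_permute_coords)
  then have "g \<circ> inv_into UNIV g = id"
    using bij_is_surj surj_iff by blast
  ultimately have "g \<circ> h \<circ> inv_into UNIV g = sign_change ?\<delta>"
    by (simp add: comp_assoc)
  then show "g \<circ> h \<circ> inv_into UNIV g \<in> Upsilon"
    using even_signs_permute[OF h(2) bij_imp_bij_inv[OF g(3)]] by (simp add: Upsilon_eq)
qed (rule subgroup_signed_permutations subgroup_Upsilon subgroup_Perms)+

text \<open>Identifies \<open>Perms\<close> with the full symmetric group; injectivity is tested on
  the standard basis vectors.\<close>

lemma permute_coords_iso:
  "permute_coords \<in> Group.iso (BijGroup (UNIV :: 'n::finite set)) (transformation_group Perms)"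
proof -
  have "permute_coords \<in> hom (BijGroup (UNIV :: 'n set)) (transformation_group Perms)"
    by (rule homI)
      (auto simp: Perms_def mult_BijGroup_UNIV bij_permute_coords permute_coords_comp)
  moreover have "inj_on permute_coords (carrier (BijGroup (UNIV :: 'n set)))"
  proof (rule inj_onI)
    fix \<sigma> \<tau> :: "'n \<Rightarrow> 'n"
    assume "\<sigma> \<in> carrier (BijGroup UNIV)" "\<tau> \<in> carrier (BijGroup UNIV)"
      and eq: "permute_coords \<sigma> = permute_coords \<tau>"
    then have bij: "bij \<sigma>" "bij \<tau>" by simp_all
    have "\<sigma> i = \<tau> i" for i
    proof -
      have "permute_coords \<sigma> (axis i 1) $ \<sigma> i = 1"
        using bij by (simp add: permute_coords_def bij_is_inj)
      then have "axis i (1 :: complex) $ inv_into UNIV \<tau> (\<sigma> i) = 1"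
        unfolding eq by (simp add: permute_coords_def)
      then have "inv_into UNIV \<tau> (\<sigma> i) = i"
        by (simp add: axis_def split: if_splits)
      then show ?thesis using bij by (metis bij_inv_eq_iff)
    qed
    then show "\<sigma> = \<tau>" ..
  qed
  ultimately show ?thesis
    by (auto simp: Group.iso_def bij_betw_def Perms_def BijGroup_def Bij_def extensional_def)
qed


section \<open>The group of polynomial automorphisms\<close>

text \<open>Evenness is what makes this work: since all signs multiply to 1, the signs other than
  \<open>\<epsilon> i\<close> multiply to \<open>\<epsilon> i\<close>, so both terms of the
  reflected coordinate change alike.\<close>

lemma sign_change_comp_b_map:
  assumes "even_signs \<epsilon>"
  shows "sign_change \<epsilon> \<circ> b_map i = b_map i \<circ> sign_change \<epsilon>"
proof -
  have "\<epsilon> i * (\<Prod>j\<in>UNIV - {i}. \<epsilon> j) = 1"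
    using assms by (simp add: even_signs_def prod.remove[of UNIV i])
  then have "(\<Prod>j\<in>UNIV - {i}. \<epsilon> j) = \<epsilon> i"
    using even_signs_square[OF assms, of i] by algebra
  then show ?thesis
    by (simp add: fun_eq_iff vec_eq_iff sign_change_def b_map_def prod.distrib algebra_simps)
qed

lemma permute_coords_comp_b_map:
  fixes \<sigma> :: "'n::finite \<Rightarrow> 'n"
  assumes "bij \<sigma>"
  shows "permute_coords \<sigma> \<circ> b_map i = b_map (\<sigma> i) \<circ> permute_coords \<sigma>"
proof -
  let ?\<tau> = "inv_into UNIV \<sigma>"
  have "bij_betw ?\<tau> (UNIV - {\<sigma> i}) (UNIV - {i})"
    using assms bij_imp_bij_inv[OF assms]
    by (auto simp: bij_betw_def bij_is_inj inj_on_def image_set_diff[of ?\<tau>] bij_inv_eq_iff)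
  then have prod: "(\<Prod>j\<in>UNIV - {\<sigma> i}. x $ ?\<tau> j) = (\<Prod>j\<in>UNIV - {i}. x $ j)" for x :: "complex ^ 'n"
    by (rule prod.reindex_bij_betw)
  have \<tau>: "?\<tau> (\<sigma> i) = i" using assms by (simp add: bij_is_inj)
  have "?\<tau> k = i \<longleftrightarrow> k = \<sigma> i" for k
    using \<tau> assms by (metis bij_inv_eq_iff)
  then show ?thesis
    by (simp add: fun_eq_iff vec_eq_iff permute_coords_def b_map_def prod \<tau>)
qed

text \<open>Conjugation by a signed permutation relabels the letters through
  \<open>\<sigma>\<close>, so signed permutations normalize \<open>Gamma_group\<close>.\<close>

lemma signed_permutation_comp_b_word:
  assumes "even_signs \<epsilon>" "bij \<sigma>"
  shows "(sign_change \<epsilon> \<circ> permute_coords \<sigma>) \<circ> b_word w =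
    b_word (map \<sigma> w) \<circ> (sign_change \<epsilon> \<circ> permute_coords \<sigma>)"
proof (induction w)
  case Nil
  then show ?case by simp
next
  case (Cons i w)
  let ?l = "sign_change \<epsilon> \<circ> permute_coords \<sigma>"
  have "?l (b_map i x) = b_map (\<sigma> i) (?l x)" for x
    using permute_coords_comp_b_map[OF assms(2), of i] sign_change_comp_b_map[OF assms(1), of "\<sigma> i"]
    by (simp add: fun_eq_iff)
  then show ?case
    using Cons.IH by (simp add: fun_eq_iff)
qed

lemma polynomial_map_signed_permutation:
  assumes "f \<in> signed_permutations"
  shows "polynomial_map f"
  using assms
  by (auto simp: signed_permutations_def polynomial_map_def sign_change_def permute_coords_def
      intro!: polynomial_function_complex_intros)

section \<open>Factorization and semidirect product for \<open>Gamma_star\<close>\<close>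

lemma Gamma_starD:
  assumes "f \<in> Gamma_star"
  shows "bij f" "polynomial_map f" "polynomial_map (inv_into UNIV f)"
    "\<And>x. markoff_hurwitz (f x) = markoff_hurwitz x"
  using assms
  by (auto simp: Gamma_star_def polynomial_automorphism_def preserves_markoff_hurwitz_iff)

lemma Gamma_starI:
  assumes "bij f" "polynomial_map f" "polynomial_map (inv_into UNIV f)"
    "\<And>x. markoff_hurwitz (f x) = markoff_hurwitz x"
  shows "f \<in> Gamma_star"
  using assms
  by (auto simp: Gamma_star_def polynomial_automorphism_def preserves_markoff_hurwitz_iff)

lemma subgroup_Gamma_star: "subgroup Gamma_star (BijGroup (UNIV :: (complex ^ 'n::finite) set))"
proof (rule subgroup_BijGroup_UNIV_I)
  show "id \<in> (Gamma_star :: (complex ^ 'n \<Rightarrow> _) set)"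
    by (rule Gamma_starI) (simp_all add: polynomial_map_id)
  fix f :: "complex ^ 'n \<Rightarrow> complex ^ 'n" assume f: "f \<in> Gamma_star"
  show "bij f" by (rule Gamma_starD[OF f])
  show "inv_into UNIV f \<in> Gamma_star"
  proof (rule Gamma_starI)
    show "bij (inv_into UNIV f)" by (rule bij_imp_bij_inv[OF Gamma_starD(1)[OF f]])
    show "markoff_hurwitz (inv_into UNIV f x) = markoff_hurwitz x" for x
      using Gamma_starD(4)[OF f, of "inv_into UNIV f x"] Gamma_starD(1)[OF f]
      by (simp add: bij_is_surj surj_f_inv_f)
  qed (use Gamma_starD[OF f] in \<open>simp_all add: inv_inv_eq\<close>)
  fix g :: "complex ^ 'n \<Rightarrow> complex ^ 'n" assume g: "g \<in> Gamma_star"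
  show "f \<circ> g \<in> Gamma_star"
    using Gamma_starD[OF f] Gamma_starD[OF g]
    by (intro Gamma_starI) (simp_all add: bij_comp o_inv_distrib polynomial_map_compose)
qed

lemma Gamma_group_subset_Gamma_star: "Gamma_group \<subseteq> Gamma_star"
  by (auto simp: Gamma_group_eq_range_b_word bij_b_word inv_b_word polynomial_map_b_word
      markoff_hurwitz_b_word intro!: Gamma_starI)

lemma signed_permutations_subset_Gamma_star: "signed_permutations \<subseteq> Gamma_star"
  by (auto simp: bij_signed_permutation inv_signed_permutation polynomial_map_signed_permutation
      markoff_hurwitz_signed_permutation intro!: Gamma_starI)

text \<open>Induction on the sum of the coordinate degrees. The reflection \<open>b_map k\<close>
  alters only coordinate \<open>k\<close>, so lowering that degree lowers the sum; when all degrees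
  are 1 the map is affine.\<close>

lemma Gamma_star_factorization:
  fixes \<Theta> :: "complex ^ 'n::finite \<Rightarrow> complex ^ 'n"
  assumes card: "CARD('n) \<ge> 3" and "\<Theta> \<in> Gamma_star"
  shows "\<exists>w. \<exists>l\<in>signed_permutations. \<Theta> = b_word w \<circ> l"
  using assms(2)
proof (induction "\<Sum>i\<in>UNIV. line_degree (\<lambda>x. \<Theta> x $ i)" arbitrary: \<Theta> rule: less_induct)
  case less
  note \<Theta> = Gamma_starD[OF less.prems]
  have poly: "polynomial_function_complex (\<lambda>x. \<Theta> x $ i)" for i
    using \<Theta>(2) by (simp add: polynomial_map_def)
  have surj: "surj (\<lambda>x. b_map k (\<Theta> x))" for k
    using bij_comp[OF \<Theta>(1) bij_b_map[of k]] by (simp add: bij_is_surj o_def)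
  consider "\<forall>i. line_degree (\<lambda>x. \<Theta> x $ i) = 1"
    | k where "line_degree (\<lambda>x. b_map k (\<Theta> x) $ k) < line_degree (\<lambda>x. \<Theta> x $ k)"
    using markoff_line_degree_alternative[OF card poly \<Theta>(4) bij_is_surj[OF \<Theta>(1)] surj] by blast
  then show ?case
  proof cases
    case 1
    have "\<forall>i. \<exists>a. \<forall>x. \<Theta> x $ i = \<Theta> 0 $ i + (\<Sum>j\<in>UNIV. a j * x $ j)"
      using 1 by (intro allI line_degree_le_1_affine[OF poly]) simp
    then have "\<exists>A. \<forall>i x. \<Theta> x $ i = \<Theta> 0 $ i + (\<Sum>j\<in>UNIV. A i j * x $ j)"
      by (rule choice)
    then obtain A where "\<And>x i. \<Theta> x $ i = \<Theta> 0 $ i + (\<Sum>j\<in>UNIV. A i j * x $ j)"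
      by blast
    then have "\<Theta> \<in> signed_permutations"
      by (rule affine_preserving_in_signed_permutations[OF card _ \<Theta>(4)])
    then have "\<exists>l\<in>signed_permutations. \<Theta> = b_word [] \<circ> l" by simp
    then show ?thesis by blast
  next
    case 2
    have "b_map k \<in> Gamma_star"
      using Gamma_group_subset_Gamma_star by (auto simp: Gamma_group_def intro: generate.incl)
    then have "b_map k \<circ> \<Theta> \<in> Gamma_star"
      using less.prems
      by (intro Gamma_starI)
        (simp_all add: Gamma_starD bij_comp o_inv_distrib polynomial_map_compose)
    moreover have "(\<Sum>i\<in>UNIV. line_degree (\<lambda>x. (b_map k \<circ> \<Theta>) x $ i)) <
        (\<Sum>i\<in>UNIV. line_degree (\<lambda>x. \<Theta> x $ i))"
    proof (rule sum_strict_mono_ex1)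
      show "\<forall>i\<in>UNIV. line_degree (\<lambda>x. (b_map k \<circ> \<Theta>) x $ i) \<le> line_degree (\<lambda>x. \<Theta> x $ i)"
      proof
        fix i
        show "line_degree (\<lambda>x. (b_map k \<circ> \<Theta>) x $ i) \<le> line_degree (\<lambda>x. \<Theta> x $ i)"
          using 2 by (cases "i = k") (simp_all add: b_map_def)
      qed
    qed (use 2 in auto)
    ultimately obtain w l where l: "l \<in> signed_permutations" "b_map k \<circ> \<Theta> = b_word w \<circ> l"
      using less.hyps[of "b_map k \<circ> \<Theta>"] by blast
    have "\<Theta> x = b_map k ((b_map k \<circ> \<Theta>) x)" for x by simp
    then have "\<Theta> = b_word (k # w) \<circ> l"
      unfolding l(2) by (simp add: fun_eq_iff)
    then show ?thesis using l(1) by blast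
  qed
qed

lemma Gamma_group_Int_signed_permutations:
  assumes card: "CARD('n::finite) \<ge> 3"
  shows "Gamma_group \<inter> signed_permutations \<subseteq> {id :: complex ^ 'n \<Rightarrow> complex ^ 'n}"
proof
  fix f :: "complex ^ 'n \<Rightarrow> complex ^ 'n" assume f: "f \<in> Gamma_group \<inter> signed_permutations"
  then obtain w' where "f = b_word w'"
    by (auto simp: Gamma_group_eq_range_b_word)
  then obtain w where w: "distinct_adj w" "f = b_word w"
    using b_word_reduced[of w'] by auto
  have "Re (f (\<chi> l. 3) $ j) \<le> 3" for j
  proof -
    obtain \<epsilon> \<sigma> where "f = sign_change \<epsilon> \<circ> permute_coords \<sigma>" "even_signs \<epsilon>"
      using f by (auto simp: signed_permutations_def)
    then have "f (\<chi> l. 3) $ j = \<epsilon> j * 3" "\<epsilon> j \<in> {1, -1}"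
      by (simp_all add: sign_change_def permute_coords_def even_signs_def)
    then show ?thesis by auto
  qed
  then have "w = []"
    using b_word_large_coordinate[OF card w(1)] w(2) by (metis not_less)
  then show "f \<in> {id}" by (simp add: w(2))
qed

lemma semidirect_product_Gamma_star:
  assumes card: "CARD('n::finite) \<ge> 3"
  shows "semidirect_product (transformation_group (Gamma_star :: (complex ^ 'n \<Rightarrow> complex ^ 'n) set))
    Gamma_group signed_permutations"
proof (rule semidirect_product_transformation_groupI)
  show "Gamma_group \<inter> signed_permutations \<subseteq> {id :: complex ^ 'n \<Rightarrow> complex ^ 'n}"
    by (rule Gamma_group_Int_signed_permutations[OF card])
  show "\<exists>h\<in>Gamma_group. \<exists>k\<in>signed_permutations. g = h \<circ> k" if "g \<in> Gamma_star"
    for g :: "complex ^ 'n \<Rightarrow> complex ^ 'n"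
    using Gamma_star_factorization[OF card that] by (auto simp: Gamma_group_eq_range_b_word)
  fix g h :: "complex ^ 'n \<Rightarrow> complex ^ 'n" assume gs: "g \<in> Gamma_star" and "h \<in> Gamma_group"
  then obtain u l w where g: "g = b_word u \<circ> l" "l \<in> signed_permutations" and h: "h = b_word w"
    using Gamma_star_factorization[OF card gs] by (auto simp: Gamma_group_eq_range_b_word)
  obtain \<sigma> where \<sigma>: "l \<circ> b_word w = b_word (map \<sigma> w) \<circ> l"
    using g(2) signed_permutation_comp_b_word by (auto simp: signed_permutations_def)
  have "bij l" using g(2) by (rule bij_signed_permutation)
  then have l: "l \<circ> inv_into UNIV l = id" using bij_is_surj surj_iff by blast
  have "inv_into UNIV g = inv_into UNIV l \<circ> b_word (rev u)"
    using \<open>bij l\<close> by (simp add: g(1) o_inv_distrib bij_b_word inv_b_word)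
  then have "g \<circ> h \<circ> inv_into UNIV g = b_word u \<circ> (l \<circ> b_word w) \<circ> inv_into UNIV l \<circ> b_word (rev u)"
    by (simp add: g(1) h o_assoc)
  also have "\<dots> = b_word u \<circ> b_word (map \<sigma> w) \<circ> (l \<circ> inv_into UNIV l) \<circ> b_word (rev u)"
    by (simp only: \<sigma> o_assoc)
  also have "\<dots> = b_word (u @ map \<sigma> w @ rev u)"
    by (simp add: l b_word_append o_assoc)
  finally show "g \<circ> h \<circ> inv_into UNIV g \<in> Gamma_group"
    by (simp add: Gamma_group_eq_range_b_word)
qed (rule subgroup_Gamma_star subgroup_Gamma_group subgroup_signed_permutations
    Gamma_group_subset_Gamma_star signed_permutations_subset_Gamma_star)+

text \<open>Every coset of \<open>N\<close> has a representative in \<open>K\<close>, because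
  \<open>N\<close> absorbs the left factor of \<open>h \<otimes> k\<close>.\<close>

lemma (in group) semidirect_product_finite_index:
  assumes "semidirect_product G N K" "finite K"
  shows "finite (rcosets N)"
proof -
  have N: "subgroup N G" and K: "K \<subseteq> carrier G" and NK: "N <#> K = carrier G"
    using assms(1) by (auto simp: semidirect_product_def normal_imp_subgroup dest: subgroup.subset)
  have "rcosets N \<subseteq> (\<lambda>k. N #> k) ` K"
  proof
    fix C assume "C \<in> rcosets N"
    then obtain x where x: "x \<in> carrier G" "C = N #> x" by (auto simp: RCOSETS_def)
    then obtain h k where hk: "h \<in> N" "k \<in> K" "x = h \<otimes> k"
      unfolding NK[symmetric] set_mult_def by blast
    then have "h \<in> carrier G" "k \<in> carrier G" using subgroup.mem_carrier[OF N] K by auto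
    then have "C = N #> k"
      using hk x(2) coset_mult_assoc[OF subgroup.subset[OF N], of h k] coset_join2[OF _ N hk(1)]
      by simp
    then show "C \<in> (\<lambda>k. N #> k) ` K" using hk(2) by blast
  qed
  then show ?thesis using assms(2) by (rule finite_surj[rotated])
qed

theorem theorem1p1:
  assumes "CARD('n::finite) \<ge> 3"
  shows "subgroup (Gamma_star :: (complex ^ 'n \<Rightarrow> complex ^ 'n) set) (BijGroup UNIV)
    \<and> semidirect_product (transformation_group (Gamma_star :: (complex ^ 'n \<Rightarrow> complex ^ 'n) set))
        Gamma_group Lambda
    \<and> semidirect_product (transformation_group (Lambda :: (complex ^ 'n \<Rightarrow> complex ^ 'n) set))
        Upsilon Perms
    \<and> permute_coords \<in> Group.iso (BijGroup (UNIV :: 'n set)) (transformation_group Perms)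
    \<and> has_presentation (transformation_group Gamma_group) (b_map :: 'n \<Rightarrow> complex ^ 'n \<Rightarrow> complex ^ 'n)
        {free_gen i \<otimes>\<^bsub>free_group\<^esub> free_gen i | i. True}
    \<and> Gamma_group \<lhd> transformation_group (Gamma_star :: (complex ^ 'n \<Rightarrow> complex ^ 'n) set)
    \<and> finite (rcosets\<^bsub>transformation_group (Gamma_star :: (complex ^ 'n \<Rightarrow> complex ^ 'n) set)\<^esub> Gamma_group)"
proof -
  note semidirect = semidirect_product_Gamma_star[OF assms]
  have "group (transformation_group (Gamma_star :: (complex ^ 'n \<Rightarrow> complex ^ 'n) set))"
    by (rule subgroup.subgroup_is_group[OF subgroup_Gamma_star group_BijGroup])
  then have "finite (rcosets\<^bsub>transformation_group (Gamma_star :: (complex ^ 'n \<Rightarrow> complex ^ 'n) set)\<^esub>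
      Gamma_group)"
    by (rule group.semidirect_product_finite_index[OF _ semidirect finite_signed_permutations])
  moreover have "Gamma_group \<lhd> transformation_group (Gamma_star :: (complex ^ 'n \<Rightarrow> complex ^ 'n) set)"
    using semidirect by (simp add: semidirect_product_def)
  ultimately show ?thesis
    using semidirect subgroup_Gamma_star semidirect_product_signed_permutations permute_coords_iso
      has_presentation_Gamma_group[OF assms]
    by (simp only: Lambda_eq_signed_permutations[OF assms] simp_thms)
qed

end
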